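(* Let $m \geqslant 2$ be an integer and let $p$ be an odd prime. Then $G(m,p)$ is a $2$-closed, nonregular permutation group (on $V\otimes W$) that is not the automorphism group of any digraph if and only if $p \in \{3, 5, 7, 13\}$.
   Context: Definition of $G(m,q)$: let $q$ be an odd prime power, $F=\mathrm{GF}(q)$, $m\geqslant 2$, and let $V$ and $W$ be vector spaces over $F$ of dimensions $2$ and $m$ respectively, with bases $\{e_1,e_2\}$ of $V$ and $\{f_1,\ldots,f_m\}$ of $W$. Let $D_8\leqslant \mathrm{GL}(2,q)$ be the group of linear transformations of $V$ generated, with respect to the basis $\{e_1,e_2\}$, by $\begin{bmatrix}1&0\\0&-1\end{bmatrix}$ and $\begin{bmatrix}0&1\\1&0\end{bmatrix}$. For $A\in \mathrm{GL}(V)$, $B\in\mathrm{GL}(W)$, $A\circ B$ denotes the linear transformation of $V\otimes W$ with $v\otimes w\mapsto v^A\otimes w^B$; for groups $H\leqslant \mathrm{GL}(V)$ and $K\leqslant\mathrm{GL}(W)$, $H\circ K=\{A\circ B\mid A\in H, B\in K\}$. Then $G(m,q)=(V\otimes W)\rtimes(D_8\circ \mathrm{GL}(m,q))\leqslant \mathrm{AGL}(2m,q)$, i.e. the group of all maps $x\mapsto x^h+t$ with $h\in D_8\circ\mathrm{GL}(m,q)$ and $t\in V\otimes W$, regarded as a permutation group on $V\otimes W$. The orbitals of a permutation group $G$ on $\Omega$ are the orbits of $G$ on $\Omega\times\Omega$. The $2$-closure of $G$ is the largest permutation group on $\Omega$ with the same orbitals as $G$; $G$ is $2$-closed if it equals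 its $2$-closure. A permutation group is regular if it is transitive with all point stabilisers trivial, and nonregular otherwise. A digraph consists of a vertex set $V(\Gamma)$ and a set of arcs $E\subseteq V(\Gamma)\times V(\Gamma)$ containing no pair $(v,v)$. A permutation group $G$ on $\Omega$ is the automorphism group of a digraph if there is a digraph $\Gamma$ with vertex set $\Omega$ such that $\mathrm{Aut}(\Gamma)=G$ as subgroups of $\mathrm{Sym}(\Omega)$. *)

theory Defs
  imports
    "HOL-Analysis.Cartesian_Space"
    "HOL-Algebra.Group_Action"
    "HOL-Algebra.Generated_Groups"
    "HOL-Computational_Algebra.Primes"
begin

text \<open>
  A permutation group on the type \<open>'a\<close> (i.e. on its universe) is a set of
  permutations that is a subgroup of \<^term>\<open>BijGroup UNIV\<close>, the symmetric group.
\<close>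

definition permutation_group :: "('a \<Rightarrow> 'a) set \<Rightarrow> bool"
  where "permutation_group G \<longleftrightarrow> subgroup G (BijGroup UNIV)"

abbreviation as_group :: "('a \<Rightarrow> 'a) set \<Rightarrow> ('a \<Rightarrow> 'a) monoid"
  where "as_group G \<equiv> (BijGroup UNIV)\<lparr>carrier := G\<rparr>"

definition regular_group :: "('a \<Rightarrow> 'a) set \<Rightarrow> bool"
  where "regular_group G \<longleftrightarrow>
    transitive_action (as_group G) UNIV (\<lambda>g. g) \<and>
    (\<forall>x. stabilizer (as_group G) (\<lambda>g. g) x = {\<one>\<^bsub>as_group G\<^esub>})"

definition orbitals :: "('a \<Rightarrow> 'a) set \<Rightarrow> ('a \<times> 'a) set set"
  where "orbitals G = orbits (as_group G) UNIV (\<lambda>g. map_prod g g)"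

definition two_closure :: "('a \<Rightarrow> 'a) set \<Rightarrow> ('a \<Rightarrow> 'a) set"
  where "two_closure G = (GREATEST H. permutation_group H \<and> orbitals H = orbitals G)"

definition two_closed :: "('a \<Rightarrow> 'a) set \<Rightarrow> bool"
  where "two_closed G \<longleftrightarrow> permutation_group G \<and> two_closure G = G"

text \<open>A digraph with vertex set \<^term>\<open>UNIV\<close> is given by its set of arcs.\<close>

definition digraph :: "('a \<times> 'a) set \<Rightarrow> bool"
  where "digraph E \<longleftrightarrow> irrefl E"

definition digraph_Aut :: "('a \<times> 'a) set \<Rightarrow> ('a \<Rightarrow> 'a) set"
  where "digraph_Aut E = {g. bij g \<and> (\<forall>u v. (u, v) \<in> E \<longleftrightarrow> (g u, g v) \<in> E)}"

lemma Bij_UNIV: "Bij UNIV = {g. bij g}"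
  by (simp add: Bij_def extensional_def)

lemma carrier_BijGroup_UNIV [simp]: "carrier (BijGroup UNIV) = {g. bij g}"
  by (simp add: BijGroup_def Bij_UNIV)

lemma one_BijGroup_UNIV [simp]: "\<one>\<^bsub>BijGroup UNIV\<^esub> = id"
  by (auto simp: BijGroup_def)

lemma mult_BijGroup_UNIV [simp]:
  "bij f \<Longrightarrow> bij g \<Longrightarrow> f \<otimes>\<^bsub>BijGroup UNIV\<^esub> g = f \<circ> g"
  by (auto simp: BijGroup_def Bij_UNIV compose_def)

lemma inv_BijGroup_UNIV [simp]:
  assumes "bij f"
  shows "inv\<^bsub>BijGroup UNIV\<^esub> f = inv_into UNIV f"
proof -
  interpret group "BijGroup UNIV :: ('a \<Rightarrow> 'a) monoid" by (rule group_BijGroup)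
  show ?thesis
    by (rule inv_equality) (use assms in \<open>auto simp: bij_imp_bij_inv bij_is_inj\<close>)
qed

lemma permutation_group_iff:
  "permutation_group G \<longleftrightarrow>
     (\<forall>g\<in>G. bij g) \<and> id \<in> G \<and> (\<forall>g\<in>G. \<forall>h\<in>G. g \<circ> h \<in> G) \<and> (\<forall>g\<in>G. inv_into UNIV g \<in> G)"
proof -
  interpret group "BijGroup UNIV :: ('a \<Rightarrow> 'a) monoid" by (rule group_BijGroup)
  show ?thesis
  proof
    assume "permutation_group G"
    then interpret subgroup G "BijGroup UNIV" by (simp add: permutation_group_def)
    have b: "\<forall>g\<in>G. bij g" using subset by auto
    then show "(\<forall>g\<in>G. bij g) \<and> id \<in> G \<and> (\<forall>g\<in>G. \<forall>h\<in>G. g \<circ> h \<in> G) \<and> (\<forall>g\<in>G. inv_into UNIV g \<in> G)"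
      using one_closed m_closed m_inv_closed by (metis inv_BijGroup_UNIV mult_BijGroup_UNIV one_BijGroup_UNIV)
  next
    assume "(\<forall>g\<in>G. bij g) \<and> id \<in> G \<and> (\<forall>g\<in>G. \<forall>h\<in>G. g \<circ> h \<in> G) \<and> (\<forall>g\<in>G. inv_into UNIV g \<in> G)"
    then show "permutation_group G"
      unfolding permutation_group_def by (intro subgroup.intro) auto
  qed
qed

lemma orbitals_eq: "orbitals G = {{(g a, g b) | g. g \<in> G} | a b. True}"
  by (auto simp: orbitals_def orbits_def orbit_def map_prod_def)

text \<open>
  The greatest element in the definition of \<^const>\<open>two_closure\<close> exists: it is the
  group of all permutations that preserve every orbital.
\<close>

lemma two_closure_eq:
  fixes G :: "('a \<Rightarrow> 'a) set"
  assumes G: "permutation_group G"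
  shows "two_closure G = {g. bij g \<and> (\<forall>D\<in>orbitals G. map_prod g g ` D = D)}" (is "_ = ?C")
proof -
  have sub: "H \<subseteq> ?C"
    if H: "permutation_group H" and eq: "orbitals H = orbitals G" for H
  proof
    fix h assume h: "h \<in> H"
    have "map_prod h h ` D = D" if D: "D \<in> orbitals H" for D
    proof -
      obtain a b where D: "D = {(g a, g b) | g. g \<in> H}" using D by (auto simp: orbitals_eq)
      have "(g a, g b) \<in> map_prod h h ` D" if g: "g \<in> H" for g
      proof (rule image_eqI)
        have "bij h" "inv_into UNIV h \<circ> g \<in> H" using H h g by (auto simp: permutation_group_iff)
        then show "((inv_into UNIV h \<circ> g) a, (inv_into UNIV h \<circ> g) b) \<in> D" unfolding D by blast
        show "(g a, g b) = map_prod h h ((inv_into UNIV h \<circ> g) a, (inv_into UNIV h \<circ> g) b)"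
          using \<open>bij h\<close> by (simp add: bij_is_surj surj_f_inv_f)
      qed
      moreover have "\<exists>k. (h (g a), h (g b)) = (k a, k b) \<and> k \<in> H" if "g \<in> H" for g
        using H h that by (intro exI[of _ "h \<circ> g"]) (auto simp: permutation_group_iff)
      ultimately show ?thesis by (fastforce simp: D)
    qed
    then show "h \<in> ?C" using H h eq by (auto simp: permutation_group_iff)
  qed
  have C: "permutation_group ?C"
    unfolding permutation_group_iff
  proof (intro conjI ballI)
    fix g h assume "g \<in> ?C" "h \<in> ?C"
    then have "map_prod (g \<circ> h) (g \<circ> h) ` D = D" if "D \<in> orbitals G" for D
      using that by (simp only: map_prod_compose image_comp[symmetric] mem_Collect_eq)
    then show "g \<circ> h \<in> ?C" using \<open>g \<in> ?C\<close> \<open>h \<in> ?C\<close> by (auto intro: bij_comp)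
  next
    fix g assume g: "g \<in> ?C"
    then have *: "map_prod g g ` D = D" if "D \<in> orbitals G" for D
      using that by auto
    have "bij g" using g by simp
    then have "inv_into UNIV g \<circ> g = id" by (simp add: bij_is_inj)
    then have **: "map_prod (inv_into UNIV g) (inv_into UNIV g) ` map_prod g g ` D = D" for D
      by (simp only: image_comp map_prod_compose[symmetric] prod.map_id0 image_id id_apply)
    have "map_prod (inv_into UNIV g) (inv_into UNIV g) ` D = D" if "D \<in> orbitals G" for D
      using *[OF that] **[of D] by simp
    then show "inv_into UNIV g \<in> ?C" using \<open>bij g\<close> by (simp add: bij_imp_bij_inv)
  qed (auto simp: prod.map_id0)
  have "orbitals ?C = orbitals G"
  proof -
    have "{(g a, g b) | g. g \<in> ?C} = {(g a, g b) | g. g \<in> G}" for a b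
    proof -
      let ?D = "{(g a, g b) | g. g \<in> G}"
      have D: "?D \<in> orbitals G" by (auto simp: orbitals_eq)
      have "id \<in> G" using G by (simp add: permutation_group_iff)
      then have ab: "(a, b) \<in> ?D" by (intro CollectI exI[of _ id]) simp
      have 1: "(g a, g b) \<in> ?D" if "g \<in> ?C" for g
      proof -
        have "map_prod g g (a, b) \<in> map_prod g g ` ?D" using ab by (rule imageI)
        also have "\<dots> = ?D" using that D by simp
        finally show ?thesis by simp
      qed
      have 2: "(g a, g b) \<in> {(g a, g b) | g. g \<in> ?C}" if "g \<in> G" for g
        using subsetD[OF sub[OF G refl] that] by (intro CollectI exI[of _ g]) simp
      show ?thesis
      proof (intro equalityI subsetI)
        fix x assume "x \<in> {(g a, g b) | g. g \<in> ?C}"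
        then obtain g where "x = (g a, g b)" "g \<in> ?C" by blast
        then show "x \<in> ?D" using 1 by simp
      next
        fix x assume "x \<in> ?D"
        then obtain g where "x = (g a, g b)" "g \<in> G" by blast
        then show "x \<in> {(g a, g b) | g. g \<in> ?C}" using 2 by simp
      qed
    qed
    then show ?thesis unfolding orbitals_eq by (simp only:)
  qed
  then show ?thesis
    unfolding two_closure_def by (intro Greatest_equality conjI C sub) auto
qed

text \<open>
  With \<open>V = F\<^sup>2\<close> and \<open>W = F\<^sup>m\<close> carrying their standard bases, \<open>V \<otimes> W\<close> is modelled as the
  coordinate space over the basis \<open>e\<^sub>i \<otimes> f\<^sub>j\<close>, indexed by pairs \<open>(i, j)\<close>.
\<close>

definition tensor :: "'f::times ^ 'n \<Rightarrow> 'f ^ 'm \<Rightarrow> 'f ^ ('n \<times> 'm)"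
  where "tensor v w = (\<chi> ij. v $ fst ij * w $ snd ij)"

definition GL :: "('f::field ^ 'n::finite \<Rightarrow> 'f ^ 'n) set"
  where "GL = {A. Vector_Spaces.linear (*s) (*s) A \<and> bij A}"

text \<open>The two generating matrices are symmetric, so acting on row or on column vectors is the same.\<close>

definition D8 :: "('f::field ^ 2 \<Rightarrow> 'f ^ 2) set"
  where "D8 = generate (BijGroup UNIV)
    {(*v) (vector [vector [1, 0], vector [0, - 1]]),
     (*v) (vector [vector [0, 1], vector [1, 0]])}"

definition tensor_map ::
    "('f::field ^ 'n::finite \<Rightarrow> 'f ^ 'n) \<Rightarrow> ('f ^ 'm::finite \<Rightarrow> 'f ^ 'm) \<Rightarrow> 'f ^ ('n \<times> 'm) \<Rightarrow> 'f ^ ('n \<times> 'm)"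
  where "tensor_map A B =
    (THE T. Vector_Spaces.linear (*s) (*s) T \<and> (\<forall>v w. T (tensor v w) = tensor (A v) (B w)))"

definition central_product ::
    "('f::field ^ 'n::finite \<Rightarrow> 'f ^ 'n) set \<Rightarrow> ('f ^ 'm::finite \<Rightarrow> 'f ^ 'm) set \<Rightarrow> ('f ^ ('n \<times> 'm) \<Rightarrow> 'f ^ ('n \<times> 'm)) set"
  where "central_product H K = {tensor_map A B | A B. A \<in> H \<and> B \<in> K}"

text \<open>
  The group \<open>G(m,q)\<close>: the field type \<open>'f\<close> stands for \<open>GF(q)\<close>, so \<open>q = CARD('f)\<close>, and the index
  type \<open>'m\<close> has \<open>m\<close> elements.
\<close>

definition G_group :: "('f::{field,finite} ^ (2 \<times> 'm::finite) \<Rightarrow> 'f ^ (2 \<times> 'm)) set"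
  where "G_group = {\<lambda>x. h x + t | h t. h \<in> central_product D8 GL}"

text \<open>The universal property of the tensor product, and well-definedness of \<^const>\<open>tensor_map\<close>.\<close>

lemma tensor_axis: "tensor (axis i 1) (axis j 1) = (axis (i, j) 1 :: 'f::field ^ ('n::finite \<times> 'm::finite))"
  by (auto simp: tensor_def axis_def vec_eq_iff)

lemma tensor_universal:
  fixes scale :: "'f::field \<Rightarrow> 'u::ab_group_add \<Rightarrow> 'u"
    and f :: "'f ^ 'n::finite \<Rightarrow> 'f ^ 'm::finite \<Rightarrow> 'u"
  assumes f1: "\<And>w. Vector_Spaces.linear (*s) scale (\<lambda>v. f v w)"
    and f2: "\<And>v. Vector_Spaces.linear (*s) scale (f v)"
  shows "\<exists>!T. Vector_Spaces.linear (*s) scale T \<and> (\<forall>v w. T (tensor v w) = f v w)"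
proof -
  interpret u: vector_space scale
    using f2 by (auto simp: Vector_Spaces.linear_def)
  have expand: "T x = (\<Sum>ij\<in>UNIV. scale (x $ ij) (T (axis ij 1)))"
    if "Vector_Spaces.linear (*s) scale T" for T and x :: "'f ^ 'k::finite"
  proof -
    interpret T: Vector_Spaces.linear "(*s)" scale T by fact
    have "T x = T (\<Sum>ij\<in>UNIV. x $ ij *s axis ij 1)" by (simp add: basis_expansion)
    then show ?thesis by (simp add: T.sum T.scale)
  qed
  define T where "T x = (\<Sum>ij\<in>UNIV. scale (x $ ij) (f (axis (fst ij) 1) (axis (snd ij) 1)))"
    for x :: "'f ^ ('n \<times> 'm)"
  have "Vector_Spaces.linear (*s) scale T"
    by unfold_locales
      (simp_all add: T_def u.scale_left_distrib sum.distrib u.scale_sum_right)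
  moreover have "T (tensor v w) = f v w" for v w
  proof -
    have "f v w = (\<Sum>i\<in>UNIV. scale (v $ i) (f (axis i 1) w))"
      using expand[OF f1] .
    also have "\<dots> = (\<Sum>i\<in>UNIV. \<Sum>j\<in>UNIV. scale (v $ i * w $ j) (f (axis i 1) (axis j 1)))"
    proof (rule sum.cong)
      fix i
      show "scale (v $ i) (f (axis i 1) w) =
        (\<Sum>j\<in>UNIV. scale (v $ i * w $ j) (f (axis i 1) (axis j 1)))"
        by (subst expand[OF f2]) (simp add: u.scale_sum_right)
    qed simp
    also have "\<dots> = T (tensor v w)"
      by (simp add: T_def tensor_def sum.cartesian_product case_prod_beta)
    finally show ?thesis by simp
  qed
  moreover have "S = T"
    if "Vector_Spaces.linear (*s) scale S" "\<forall>v w. S (tensor v w) = f v w" for S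
  proof
    fix x
    have "S (axis ij 1) = f (axis (fst ij) 1) (axis (snd ij) 1)" for ij :: "'n \<times> 'm"
      using that(2) by (metis prod.collapse tensor_axis)
    then show "S x = T x" using expand[OF that(1), of x] by (simp add: T_def)
  qed
  ultimately show ?thesis by blast
qed

lemma tensor_map:
  fixes A :: "'f::field ^ 'n::finite \<Rightarrow> 'f ^ 'n" and B :: "'f ^ 'm::finite \<Rightarrow> 'f ^ 'm"
  assumes A: "Vector_Spaces.linear (*s) (*s) A" and B: "Vector_Spaces.linear (*s) (*s) B"
  shows "Vector_Spaces.linear (*s) (*s) (tensor_map A B)"
    and "tensor_map A B (tensor v w) = tensor (A v) (B w)"
proof -
  interpret A: Vector_Spaces.linear "(*s)" "(*s)" A by fact
  interpret B: Vector_Spaces.linear "(*s)" "(*s)" B by fact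
  have "\<exists>!T. Vector_Spaces.linear (*s) (*s) T \<and> (\<forall>v w. T (tensor v w) = tensor (A v) (B w))"
  proof (rule tensor_universal)
    show "Vector_Spaces.linear (*s) (*s) (\<lambda>v. tensor (A v) (B w))" for w
      by unfold_locales (simp_all add: A.add A.scale tensor_def vec_eq_iff algebra_simps)
    show "Vector_Spaces.linear (*s) (*s) (\<lambda>w. tensor (A v) (B w))" for v
      by unfold_locales (simp_all add: B.add B.scale tensor_def vec_eq_iff algebra_simps)
  qed
  from theI'[OF this]
  show "Vector_Spaces.linear (*s) (*s) (tensor_map A B)"
    and "tensor_map A B (tensor v w) = tensor (A v) (B w)"
    by (auto simp: tensor_map_def)
qed

end

theory Submission
  imports Defs "HOL-Number_Theory.Residues"
begin

text \<open>
  A vector of \<open>V \<otimes> W\<close> is a pair of vectors of \<open>W\<close>, its rows. For a nonzero \<open>s \<in> F\<^sup>2\<close> the map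
  \<open>form s x = s\<^sub>1 x\<^sub>1 + s\<^sub>2 x\<^sub>2\<close> has as level sets a class of parallel lines, one class for each point of the
  projective line, called a direction. Two vectors are on a common line iff their difference has rank at most
  one. By the transitivity of \<open>GL(W)\<close>, the nontrivial orbitals of the group are the pairs with a difference of
  rank two and, for each orbit of \<open>D8\<close> on directions, the pairs of points on a common line with direction in
  this orbit. Modulo scalars \<open>D8\<close> is the Klein four-group \<open>z \<mapsto> z, -z, 1/z, -1/z\<close>.

  Joining points on a common line with direction in a set \<open>R\<close> gives a graph. When lines have more than
  \<open>(|R| - 1)\<^sup>2\<close> points, they can be recovered as large cliques, so that automorphisms permute the
  directions in \<open>R\<close> (\<open>net_automorphism_permutes_classes\<close>). A bijection that maps three parallel
  classes to parallel classes is of the form \<open>x \<mapsto> (M \<circ> B) x + b\<close> with \<open>M \<in> GL(2, p)\<close> and \<open>B \<in> GL(m, p)\<close>, because \<open>p\<close> is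
  prime (\<open>three_classes_affine\<close>). The question becomes which projectivities stabilise which sets of
  directions.

  For every odd \<open>p\<close>, a matrix that stabilises both \<open>{0, \<infinity>}\<close> and \<open>{1, -1}\<close> is a scalar multiple of an
  element of \<open>D8\<close>. So the group is the intersection of two automorphism groups of graphs and therefore
  2-closed (\<open>G_group_eq_Int_Aut\<close>, \<open>two_closed_Int_digraph_Aut\<close>). It is not regular since \<open>x \<mapsto> -x\<close>
  fixes \<open>0\<close>.

  It is the automorphism group of a graph if some union of orbits of \<open>D8\<close> on directions has no further stabiliser
  in \<open>PGL(2, p)\<close>. A single orbit \<open>{t, -t, 1/t, -1/t}\<close> will do unless its cross-ratio is harmonic
  or equianharmonic (\<open>klein_orbit_rigid\<close>). For \<open>t = 2\<close> this excludes the primes 7, 13, 17, 37 and 41, and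
  the orbit degenerates for 3 and 5; the primes 37 and 41 are handled by \<open>t = 4\<close>, and 17 by
  a union of two orbits (\<open>exists_digraph\<close>).

  For 5, 7 and 13, every union of orbits is stabilised by a matrix outside the scalar multiples of \<open>D8\<close>; this
  is a finite verification. For the union formed by the directions of the arcs of a digraph preserved by the
  group, such a matrix is an automorphism, as it also preserves the rank of differences. For \<open>p = 3\<close> the
  same works unless exactly one of the two orbits belongs to arcs. Then the digraph is a square grid or its complement, whose automorphism group is
  far larger (\<open>two_directions_imp_automorphism_outside\<close>).
\<close>

section \<open>Cliques and automorphisms of nets\<close>

text \<open>
  A point off a line of a net with \<open>k\<close> parallel classes is adjacent to at most \<open>k - 1\<close> of its points.
  So if a clique is on no line, each of the \<open>k\<close> lines through one of its points carries at most
  \<open>k - 2\<close> further points of it, and the clique has at most \<open>1 + k (k - 2) = (k - 1)\<^sup>2\<close> points.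
  The maps \<open>\<phi> s\<close> label the lines of class \<open>s\<close>.
\<close>

lemma large_clique_in_line:
  fixes \<phi> :: "'r \<Rightarrow> 'a \<Rightarrow> 'w"
  assumes fin: "finite R" "R \<noteq> {}" "finite C"
    and meet: "\<And>s t x y. s \<in> R \<Longrightarrow> t \<in> R \<Longrightarrow> s \<noteq> t \<Longrightarrow> \<phi> s x = \<phi> s y \<Longrightarrow> \<phi> t x = \<phi> t y \<Longrightarrow> x = y"
    and clique: "\<And>x y. x \<in> C \<Longrightarrow> y \<in> C \<Longrightarrow> x \<noteq> y \<Longrightarrow> \<exists>s\<in>R. \<phi> s x = \<phi> s y"
    and large: "(card R - 1)\<^sup>2 < card C"
  shows "\<exists>s\<in>R. \<forall>x\<in>C. \<forall>y\<in>C. \<phi> s x = \<phi> s y"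
proof (rule ccontr)
  assume neg: "\<not> ?thesis"
  obtain c where c: "c \<in> C" using large by (metis card.empty ex_in_conv not_less_zero)
  define L where "L s = {x \<in> C. \<phi> s x = \<phi> s c}" for s
  have L_small: "card (L s) \<le> card R - 1" if s: "s \<in> R" for s
  proof -
    obtain y where y: "y \<in> C" "\<phi> s y \<noteq> \<phi> s c" using neg s by metis
    define dir where "dir x = (SOME t. t \<in> R \<and> \<phi> t x = \<phi> t y)" for x
    have dir: "dir x \<in> R \<and> \<phi> (dir x) x = \<phi> (dir x) y" if "x \<in> L s" for x
      unfolding dir_def by (rule someI_ex) (use that clique[of x y] y in \<open>auto simp: L_def\<close>)
    have "inj_on dir (L s)"
    proof (rule inj_onI)
      fix x x' assume xx: "x \<in> L s" "x' \<in> L s" "dir x = dir x'"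
      then have "dir x \<noteq> s" using dir[of x] y by (auto simp: L_def)
      moreover have "\<phi> (dir x) x = \<phi> (dir x) x'" using dir[OF xx(1)] dir[OF xx(2)] xx(3) by simp
      ultimately show "x = x'"
        using meet[of "dir x" s x x'] dir[OF xx(1)] s xx by (auto simp: L_def)
    qed
    moreover have "dir ` L s \<subseteq> R - {s}"
      using dir y by (fastforce simp: L_def)
    ultimately have "card (L s) \<le> card (R - {s})"
      using fin by (intro card_inj_on_le) auto
    then show ?thesis using s fin by simp
  qed
  obtain s0 where "s0 \<in> R" using fin by blast
  have "C \<subseteq> insert c (\<Union>s\<in>R. L s - {c})"
    using clique c by (fastforce simp: L_def)
  then have "card C \<le> card (insert c (\<Union>s\<in>R. L s - {c}))"
    using fin by (intro card_mono) (auto simp: L_def)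
  also have "\<dots> \<le> 1 + card (\<Union>s\<in>R. L s - {c})"
    using card_Un_le[of "{c}" "\<Union>s\<in>R. L s - {c}"] by simp
  also have "\<dots> \<le> 1 + (\<Sum>s\<in>R. card (L s - {c}))"
    using fin by (intro add_left_mono card_UN_le)
  also have "\<dots> \<le> 1 + (\<Sum>s\<in>R. card R - 2)"
  proof (intro add_left_mono sum_mono)
    fix s assume "s \<in> R"
    then show "card (L s - {c}) \<le> card R - 2"
      using L_small[of s] c fin by (simp add: L_def card_Diff_singleton)
  qed
  also have "\<dots> = (card R - 1)\<^sup>2"
  proof -
    have "c \<in> L s0" "finite (L s0)" using c fin by (auto simp: L_def)
    then have "card (L s0) > 0" using card_gt_0_iff by blast
    then have "card R \<ge> 2" using L_small[OF \<open>s0 \<in> R\<close>] by linarith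
    then obtain n where "card R = Suc (Suc n)" by (metis add_2_eq_Suc le_Suc_ex)
    then show ?thesis by (simp add: power2_eq_square)
  qed
  finally show False using large by simp
qed

definition net_arcs :: "'r set \<Rightarrow> ('r \<Rightarrow> 'a \<Rightarrow> 'w) \<Rightarrow> ('a \<times> 'a) set"
  where "net_arcs R \<phi> = {(x, y). x \<noteq> y \<and> (\<exists>s\<in>R. \<phi> s x = \<phi> s y)}"

lemma digraph_net_arcs: "digraph (net_arcs R \<phi>)"
  by (auto simp: digraph_def net_arcs_def irrefl_def)

text \<open>
  A line is a clique with \<open>CARD('w)\<close> points, so by the previous bound its image lies on a line and
  fills it. Lines of one class are disjoint, whereas lines of different classes meet; hence the
  images of parallel lines are parallel and the automorphism induces a permutation of the classes.
\<close>

lemma net_automorphism_permutes_classes: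
  fixes \<phi> :: "'r \<Rightarrow> 'a::finite \<Rightarrow> 'w::finite"
  assumes R: "finite R" "card R \<ge> 2"
    and coords: "\<And>s t. s \<in> R \<Longrightarrow> t \<in> R \<Longrightarrow> s \<noteq> t \<Longrightarrow> bij (\<lambda>x. (\<phi> s x, \<phi> t x))"
    and large: "(card R - 1)\<^sup>2 < CARD('w)"
    and g: "g \<in> digraph_Aut (net_arcs R \<phi>)"
  shows "\<exists>\<sigma>. \<sigma> ` R \<subseteq> R \<and> inj_on \<sigma> R \<and>
    (\<forall>s\<in>R. \<forall>x y. \<phi> s x = \<phi> s y \<longrightarrow> \<phi> (\<sigma> s) (g x) = \<phi> (\<sigma> s) (g y))"
proof -
  have bij_g: "bij g" and arcs: "\<And>x y. (x, y) \<in> net_arcs R \<phi> \<longleftrightarrow> (g x, g y) \<in> net_arcs R \<phi>"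
    using g by (auto simp: digraph_Aut_def)
  have meet: "x = y" if "s \<in> R" "t \<in> R" "s \<noteq> t" "\<phi> s x = \<phi> s y" "\<phi> t x = \<phi> t y" for s t x y
    using injD[OF bij_is_inj[OF coords[OF that(1-3)]], of x y] that(4,5) by simp
  have join: "\<exists>x. \<phi> s x = a \<and> \<phi> t x = b" if "s \<in> R" "t \<in> R" "s \<noteq> t" for s t a b
    using surjD[OF bij_is_surj[OF coords[OF that]], of "(a, b)"] by force
  have "R \<noteq> {}" using R by auto
  have other: "\<exists>t\<in>R. t \<noteq> s" if "s \<in> R" for s
  proof (rule ccontr)
    assume "\<not> ?thesis"
    then have "R = {s}" using that by blast
    then show False using R by simp
  qed
  have W: "2 \<le> CARD('w)"
  proof -
    have "1 \<le> (card R - 1)\<^sup>2" using R by simp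
    then show ?thesis using large by linarith
  qed
  define line where "line s c = {x. \<phi> s x = c}" for s c
  have card_line: "card (line s c) = CARD('w)" if "s \<in> R" for s c
  proof -
    obtain t where t: "t \<in> R" "t \<noteq> s" using other[OF \<open>s \<in> R\<close>] by blast
    have "inj_on (\<phi> t) (line s c)"
      using meet[OF that t(1)] t(2) by (auto simp: line_def inj_on_def)
    moreover have "d \<in> \<phi> t ` line s c" for d
    proof -
      obtain x where "\<phi> s x = c" "\<phi> t x = d" using join[OF \<open>s \<in> R\<close> t(1)] t(2) by metis
      then show ?thesis by (auto simp: line_def)
    qed
    ultimately have "bij_betw (\<phi> t) (line s c) UNIV" by (auto simp: bij_betw_def)
    then show ?thesis by (rule bij_betw_same_card)
  qed
  have image_line: "\<exists>t\<in>R. \<exists>d. g ` line s c = line t d" if s: "s \<in> R" for s c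
  proof -
    have card_im: "card (g ` line s c) = CARD('w)"
      using card_image[OF inj_on_subset[OF bij_is_inj[OF bij_g] subset_UNIV], of "line s c"] card_line[OF s] by simp
    have "\<exists>t\<in>R. \<forall>x\<in>g ` line s c. \<forall>y\<in>g ` line s c. \<phi> t x = \<phi> t y"
    proof (rule large_clique_in_line)
      show "x = y" if "s \<in> R" "t \<in> R" "s \<noteq> t" "\<phi> s x = \<phi> s y" "\<phi> t x = \<phi> t y" for s t x y
        using meet that by blast
      show "\<exists>t\<in>R. \<phi> t x = \<phi> t y" if xy: "x \<in> g ` line s c" "y \<in> g ` line s c" "x \<noteq> y" for x y
      proof -
        obtain x' y' where xy': "x = g x'" "y = g y'" "x' \<in> line s c" "y' \<in> line s c" "x' \<noteq> y'"
          using xy by auto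
        then have "(x', y') \<in> net_arcs R \<phi>" using s by (force simp: net_arcs_def line_def)
        then show ?thesis using arcs[of x' y'] xy' by (auto simp: net_arcs_def)
      qed
      show "(card R - 1)\<^sup>2 < card (g ` line s c)" using card_im large by simp
    qed (use R \<open>R \<noteq> {}\<close> in auto)
    then obtain t where t: "t \<in> R" "\<forall>x\<in>g ` line s c. \<forall>y\<in>g ` line s c. \<phi> t x = \<phi> t y" by blast
    have "g ` line s c \<noteq> {}" using card_im W by auto
    then obtain x0 where "x0 \<in> g ` line s c" by blast
    then have "g ` line s c \<subseteq> line t (\<phi> t x0)" using t by (auto simp: line_def)
    moreover have "card (line t (\<phi> t x0)) = card (g ` line s c)" using card_im card_line t by simp
    ultimately have "g ` line s c = line t (\<phi> t x0)" by (intro card_subset_eq) auto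
    then show ?thesis using t by blast
  qed
  have "\<exists>t\<in>R. \<forall>x y. \<phi> s x = \<phi> s y \<longrightarrow> \<phi> t (g x) = \<phi> t (g y)" if s: "s \<in> R" for s
  proof -
    \<comment> \<open>The line with label \<open>undefined\<close> is an arbitrary reference line of class \<open>s\<close>.\<close>
    obtain t d where t: "t \<in> R" "g ` line s undefined = line t d" using image_line[OF s] by blast
    have "\<exists>d'. g ` line s c = line t d'" for c
    proof (cases "c = undefined")
      case False
      obtain t' d' where t': "t' \<in> R" "g ` line s c = line t' d'" using image_line[OF s] by blast
      have "line s c \<inter> line s undefined = {}" using False by (auto simp: line_def)
      then have "line t' d' \<inter> line t d = {}"
        using image_Int[OF bij_is_inj[OF bij_g], of "line s c" "line s undefined"] t t' by simp
      then have "t' = t" using join[OF t'(1) t(1), of d' d] by (auto simp: line_def)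
      then show ?thesis using t' by blast
    qed (use t in blast)
    then have "\<phi> t (g x) = \<phi> t (g y)" if "\<phi> s x = \<phi> s y" for x y
    proof -
      obtain d' where "g ` line s (\<phi> s x) = line t d'" using \<open>\<And>c. \<exists>d'. g ` line s c = line t d'\<close> by blast
      moreover have "x \<in> line s (\<phi> s x)" "y \<in> line s (\<phi> s x)" using that by (auto simp: line_def)
      ultimately have "g x \<in> line t d'" "g y \<in> line t d'" by blast+
      then show ?thesis by (simp add: line_def)
    qed
    then show ?thesis using t by blast
  qed
  then obtain \<sigma> where \<sigma>: "\<And>s. s \<in> R \<Longrightarrow> \<sigma> s \<in> R"
    "\<And>s x y. s \<in> R \<Longrightarrow> \<phi> s x = \<phi> s y \<Longrightarrow> \<phi> (\<sigma> s) (g x) = \<phi> (\<sigma> s) (g y)" by metis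
  have "inj_on \<sigma> R"
  proof (rule inj_onI, rule ccontr)
    fix s s' assume ss: "s \<in> R" "s' \<in> R" "\<sigma> s = \<sigma> s'" "s \<noteq> s'"
    have const: "\<phi> (\<sigma> s) (g x) = \<phi> (\<sigma> s) (g y)" for x y
    proof -
      obtain z where "\<phi> s z = \<phi> s x" "\<phi> s' z = \<phi> s' y" using join ss by blast
      then show ?thesis using \<sigma>(2)[OF ss(1), of z x] \<sigma>(2)[OF ss(2), of z y] ss(3) by simp
    qed
    have "surj (\<phi> (\<sigma> s))"
      unfolding surj_def
    proof
      fix d
      obtain t where "t \<in> R" "t \<noteq> \<sigma> s" using other[OF \<sigma>(1)[OF ss(1)]] by blast
      then show "\<exists>x. d = \<phi> (\<sigma> s) x" using join[OF \<sigma>(1)[OF ss(1)]] by metis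
    qed
    then have surj: "surj (\<phi> (\<sigma> s) \<circ> g)" using bij_is_surj[OF bij_g] by (rule comp_surj[rotated])
    have eq: "c = d" for c d :: 'w
    proof -
      obtain x y where "c = (\<phi> (\<sigma> s) \<circ> g) x" "d = (\<phi> (\<sigma> s) \<circ> g) y"
        using surjD[OF surj] by blast
      then show ?thesis using const[of x y] by simp
    qed
    have "CARD('w) \<le> Suc 0" unfolding card_le_Suc0_iff_eq[OF finite] by (intro ballI eq)
    then show False using W by simp
  qed
  then show ?thesis using \<sigma> by blast
qed

section \<open>Coordinates on the tensor product\<close>

definition tensor_row :: "2 \<Rightarrow> 'f ^ (2 \<times> 'm::finite) \<Rightarrow> 'f ^ 'm"
  where "tensor_row i x = (\<chi> j. x $ (i, j))"

lemma tensor_row_nth [simp]: "tensor_row i x $ j = x $ (i, j)"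
  by (simp add: tensor_row_def)

definition stack :: "'f ^ 'm \<Rightarrow> 'f ^ 'm \<Rightarrow> 'f ^ (2 \<times> 'm::finite)"
  where "stack u v = (\<chi> ij. if fst ij = 1 then u $ snd ij else v $ snd ij)"

lemma tensor_row_stack [simp]: "tensor_row 1 (stack u v) = u" "tensor_row 2 (stack u v) = v"
  by (simp_all add: stack_def vec_eq_iff)

lemma stack_eqI: "tensor_row 1 x = tensor_row 1 y \<Longrightarrow> tensor_row 2 x = tensor_row 2 y \<Longrightarrow> x = y"
proof -
  assume rows: "tensor_row 1 x = tensor_row 1 y" "tensor_row 2 x = tensor_row 2 y"
  have "x $ (i, j) = y $ (i, j)" for i j
    using rows exhaust_2[of i] by (auto simp: vec_eq_iff)
  then show "x = y" by (auto simp: vec_eq_iff)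
qed

lemma stack_rows [simp]: "stack (tensor_row 1 x) (tensor_row 2 x) = x"
  by (rule stack_eqI) simp_all

lemma stack_inject [simp]: "stack u v = stack u' v' \<longleftrightarrow> u = u' \<and> v = v'"
  by (metis tensor_row_stack)

lemma stack_add: "stack u v + stack u' v' = stack (u + u') (v + v')"
  by (auto simp: stack_def vec_eq_iff)

lemma stack_diff: "stack u v - stack u' v' = stack (u - u') (v - v')"
  by (auto simp: stack_def vec_eq_iff)

lemma stack_zero [simp]: "stack 0 0 = 0"
  by (auto simp: stack_def vec_eq_iff)

lemma row_add [simp]: "tensor_row i (x + y) = tensor_row i x + tensor_row i y"
  by (auto simp: vec_eq_iff)

lemma row_zero [simp]: "tensor_row i 0 = 0"
  by (auto simp: vec_eq_iff)

lemma row_scale [simp]: "tensor_row i (c *s x) = c *s tensor_row i (x :: 'f::times ^ (2 \<times> 'm::finite))"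
  by (auto simp: vec_eq_iff)

text \<open>
  For \<open>s \<noteq> 0\<close> the level sets of \<open>form s\<close> are the translates of \<open>v \<otimes> W\<close>, where \<open>v\<close> spans the
  annihilator of \<open>s\<close>. They depend only on the point of the projective line spanned by \<open>s\<close>, which is
  called a direction below. A difference of two vectors has rank at most one iff they agree
  under some \<open>form s\<close> with \<open>s \<noteq> 0\<close>.
\<close>

definition form :: "'f \<times> 'f \<Rightarrow> 'f::field ^ (2 \<times> 'm::finite) \<Rightarrow> 'f ^ 'm"
  where "form s x = fst s *s tensor_row 1 x + snd s *s tensor_row 2 x"

definition det2 :: "'f::field \<times> 'f \<Rightarrow> 'f \<times> 'f \<Rightarrow> 'f"
  where "det2 s t = fst s * snd t - snd s * fst t"

lemma det2_self [simp]: "det2 s s = 0"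
  by (simp add: det2_def)

lemma det2_swap: "det2 s t = 0 \<longleftrightarrow> det2 t s = 0"
  by (auto simp: det2_def algebra_simps)

lemma form_add: "form s (x + y) = form s x + form s y"
  by (auto simp: form_def vec_eq_iff algebra_simps)

lemma form_diff: "form s (x - y) = form s x - form s y"
  by (auto simp: form_def vec_eq_iff algebra_simps)

lemma form_zero [simp]: "form s 0 = 0"
  by (auto simp: form_def vec_eq_iff)

lemma form_stack: "form s (stack u v) = fst s *s u + snd s *s v"
  by (simp add: form_def)

lemma bij_forms:
  fixes s t :: "'f::field \<times> 'f"
  assumes D: "det2 s t \<noteq> 0"
  shows "bij (\<lambda>x :: 'f ^ (2 \<times> 'm::finite). (form s x, form t x))"
proof (rule o_bij)
  let ?D = "det2 s t"
  let ?h = "\<lambda>(u, v). stack ((snd t / ?D) *s u - (snd s / ?D) *s v) ((fst s / ?D) *s v - (fst t / ?D) *s u)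
    :: 'f ^ (2 \<times> 'm::finite)"
  have eq: "?D = fst s * snd t - snd s * fst t" by (simp add: det2_def)
  have 1: "form s (?h (u, v)) = u" for u v
    using D by (simp add: form_def vec_eq_iff field_simps) (simp add: eq algebra_simps)
  have 2: "form t (?h (u, v)) = v" for u v
    using D by (simp add: form_def vec_eq_iff field_simps) (simp add: eq algebra_simps)
  show "(\<lambda>x. (form s x, form t x)) \<circ> ?h = id"
    using 1 2 by (auto simp: fun_eq_iff)
  have "?h (form s x, form t x) = x" for x :: "'f ^ (2 \<times> 'm::finite)"
  proof (rule stack_eqI)
    show "tensor_row 1 (?h (form s x, form t x)) = tensor_row 1 x"
      using D by (simp add: form_def vec_eq_iff field_simps) (simp add: eq algebra_simps)
    show "tensor_row 2 (?h (form s x, form t x)) = tensor_row 2 x"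
      using D by (simp add: form_def vec_eq_iff field_simps) (simp add: eq algebra_simps)
  qed
  then show "?h \<circ> (\<lambda>x. (form s x, form t x)) = id" by (auto simp: fun_eq_iff)
qed

lemma form_eq_iff:
  fixes x y :: "'f::field ^ (2 \<times> 'm::finite)"
  assumes "det2 s t \<noteq> 0"
  shows "form s x = form s y \<and> form t x = form t y \<longleftrightarrow> x = y"
  using injD[OF bij_is_inj[OF bij_forms[OF assms]], of x y] by auto

text \<open>
  A pair of pairs is read as the \<open>2 \<times> 2\<close> matrix with these rows. Directions are row vectors, on which
  matrices act from the right (\<open>vec_mat\<close>), because \<open>form\<close> is dual to the factor \<open>V\<close>.
\<close>

type_synonym 'f mat2 = "('f \<times> 'f) \<times> ('f \<times> 'f)"

definition vec_mat :: "'f::field \<times> 'f \<Rightarrow> 'f mat2 \<Rightarrow> 'f \<times> 'f"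
  where "vec_mat s M = (fst s * fst (fst M) + snd s * fst (snd M), fst s * snd (fst M) + snd s * snd (snd M))"

definition det_mat :: "'f::field mat2 \<Rightarrow> 'f"
  where "det_mat M = det2 (fst M) (snd M)"

definition kron :: "'f::field mat2 \<Rightarrow> ('f ^ 'm \<Rightarrow> 'f ^ 'm) \<Rightarrow> 'f ^ (2 \<times> 'm::finite) \<Rightarrow> 'f ^ (2 \<times> 'm::finite)"
  where "kron M B x = stack (B (form (fst M) x)) (B (form (snd M) x))"

lemma GL_linear:
  assumes "B \<in> GL"
  shows "B (u + v) = B u + B v" "B (c *s u) = c *s B u" "B 0 = 0" "B (u - v) = B u - B v" "B (- u) = - B u"
proof -
  interpret B: Vector_Spaces.linear "(*s)" "(*s)" B using assms by (simp add: GL_def)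
  show "B (u + v) = B u + B v" "B (c *s u) = c *s B u" "B 0 = 0" "B (u - v) = B u - B v" "B (- u) = - B u"
    by (simp_all add: B.add B.scale B.zero B.diff B.neg)
qed

lemma GL_bij: "B \<in> GL \<Longrightarrow> bij B"
  by (simp add: GL_def)

lemma GL_I:
  assumes "bij B" "\<And>u v. B (u + v) = B u + B v" "\<And>c u. B (c *s u) = c *s B u"
  shows "B \<in> GL"
proof -
  have "Vector_Spaces.linear (*s) (*s) B" by unfold_locales (use assms in auto)
  then show ?thesis using assms by (simp add: GL_def)
qed

text \<open>
  This duality turns every question about images of lines under \<open>kron M B\<close> into the action
  of \<open>M\<close> on directions.
\<close>

lemma form_kron:
  assumes "B \<in> GL"
  shows "form s (kron M B x) = B (form (vec_mat s M) x)"
proof -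
  have "form s (kron M B x) = B (fst s *s form (fst M) x + snd s *s form (snd M) x)"
    by (simp add: kron_def form_stack GL_linear[OF assms])
  also have "fst s *s form (fst M) x + snd s *s form (snd M) x = form (vec_mat s M) x"
    by (simp add: form_def vec_mat_def vec_eq_iff algebra_simps)
  finally show ?thesis .
qed

lemma det2_vec_mat: "det2 (vec_mat s M) (vec_mat t M) = det2 s t * det_mat M"
  by (simp add: det2_def det_mat_def vec_mat_def algebra_simps)

lemma bij_kron:
  fixes B :: "'f::field ^ 'm::finite \<Rightarrow> 'f ^ 'm"
  assumes "B \<in> GL" "det_mat M \<noteq> 0"
  shows "bij (kron M B)"
proof -
  have "bij (\<lambda>x. (form (fst M) x, form (snd M) x))" (is "bij ?f")
    using assms(2) by (intro bij_forms) (simp add: det_mat_def)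
  moreover have "bij (map_prod B B)"
    using GL_bij[OF assms(1)] by (auto simp: bij_def prod.inj_map map_prod_surj)
  moreover have "bij (\<lambda>(u, v). stack u v :: 'f ^ (2 \<times> 'm::finite))"
    by (rule o_bij[of "\<lambda>x. (tensor_row 1 x, tensor_row 2 x)"]) (auto simp: fun_eq_iff)
  ultimately have "bij ((\<lambda>(u, v). stack u v) \<circ> map_prod B B \<circ> ?f)"
    by (intro bij_comp)
  also have "(\<lambda>(u, v). stack u v) \<circ> map_prod B B \<circ> ?f = kron M B"
    by (simp add: fun_eq_iff kron_def)
  finally show ?thesis .
qed

definition D8_mats :: "'f::field mat2 set"
  where "D8_mats =
    {((1, 0), (0, 1)), ((1, 0), (0, -1)), ((-1, 0), (0, 1)), ((-1, 0), (0, -1)),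
     ((0, 1), (1, 0)), ((0, 1), (-1, 0)), ((0, -1), (1, 0)), ((0, -1), (-1, 0))}"

definition mat_map :: "'f::field mat2 \<Rightarrow> 'f ^ 2 \<Rightarrow> 'f ^ 2"
  where "mat_map M = (*v) (vector [vector [fst (fst M), snd (fst M)], vector [fst (snd M), snd (snd M)]])"

lemma mat_map_nth [simp]:
  "mat_map M v $ 1 = fst (fst M) * v $ 1 + snd (fst M) * v $ 2"
  "mat_map M v $ 2 = fst (snd M) * v $ 1 + snd (snd M) * v $ 2"
  by (simp_all add: mat_map_def matrix_vector_mult_def sum_2)

definition mat_mult :: "'f::field mat2 \<Rightarrow> 'f mat2 \<Rightarrow> 'f mat2"
  where "mat_mult M N = (vec_mat (fst M) N, vec_mat (snd M) N)"

lemma mat_map_comp: "mat_map M \<circ> mat_map N = mat_map (mat_mult M N)"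
  by (rule ext) (simp add: vec_eq_iff forall_2 mat_mult_def vec_mat_def algebra_simps)

lemma mat_map_id: "mat_map ((1, 0), (0, 1)) = id"
  by (rule ext) (simp add: vec_eq_iff forall_2)

lemma D8_mats_mult: "M \<in> D8_mats \<Longrightarrow> N \<in> D8_mats \<Longrightarrow> mat_mult M N \<in> D8_mats"
  unfolding D8_mats_def by (elim insertE emptyE; simp add: mat_mult_def vec_mat_def)

lemma D8_mats_inverse:
  assumes "M \<in> D8_mats"
  shows "\<exists>N\<in>D8_mats. mat_mult M N = ((1, 0), (0, 1)) \<and> mat_mult N M = ((1, 0), (0, 1))"
proof (rule bexI)
  let ?N = "((fst (fst M), fst (snd M)), (snd (fst M), snd (snd M)))"
  show "mat_mult M ?N = ((1, 0), (0, 1)) \<and> mat_mult ?N M = ((1, 0), (0, 1))" "?N \<in> D8_mats"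
    using assms unfolding D8_mats_def by (elim insertE emptyE; simp add: mat_mult_def vec_mat_def)+
qed

lemma D8_eq: "(D8 :: ('f::field ^ 2 \<Rightarrow> 'f ^ 2) set) = mat_map ` D8_mats"
proof -
  let ?r = "((1, 0), (0, -1)) :: 'f mat2" and ?s = "((0, 1), (1, 0)) :: 'f mat2"
  let ?gen = "generate (BijGroup UNIV) {mat_map ?r, mat_map ?s}"
  have D8: "D8 = ?gen" by (simp add: D8_def mat_map_def)
  have bij: "bij (mat_map M)" if "M \<in> D8_mats" for M :: "'f mat2"
    using D8_mats_inverse[OF that] by (metis mat_map_comp mat_map_id o_bij)
  have rs: "?r \<in> D8_mats" "?s \<in> D8_mats" by (auto simp: D8_mats_def)
  have "A \<in> mat_map ` D8_mats" if "A \<in> ?gen" for A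
    using that
  proof induction
    case one
    have "((1, 0), (0, 1)) \<in> D8_mats" by (auto simp: D8_mats_def)
    then show ?case using mat_map_id by (metis image_eqI one_BijGroup_UNIV)
  next
    case (incl h)
    then show ?case using rs by blast
  next
    case (inv h)
    have "mat_map ?r \<circ> mat_map ?r = id" "mat_map ?s \<circ> mat_map ?s = id"
      by (simp_all add: mat_map_comp mat_mult_def vec_mat_def mat_map_id)
    then have "inv_into UNIV h = h" using inv by (auto simp: inv_unique_comp)
    then show ?case using inv rs bij by auto
  next
    case (eng h1 h2)
    then obtain M N where MN: "M \<in> D8_mats" "N \<in> D8_mats" "h1 = mat_map M" "h2 = mat_map N" by blast
    then show ?case using bij mat_map_comp D8_mats_mult by (metis image_eqI mult_BijGroup_UNIV)
  qed
  moreover have "mat_map M \<in> ?gen" if M: "M \<in> D8_mats" for M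
  proof -
    have gen: "mat_map ?r \<in> ?gen" "mat_map ?s \<in> ?gen" by (auto intro: generate.incl)
    have mult: "mat_map (mat_mult M N) \<in> ?gen"
      if "mat_map M \<in> ?gen" "mat_map N \<in> ?gen" "M \<in> D8_mats" "N \<in> D8_mats" for M N
      using generate.eng[OF that(1,2)] bij[OF that(3)] bij[OF that(4)] by (simp add: mat_map_comp)
    define a where "a = mat_mult ?r ?s"
    define b where "b = mat_mult ?s ?r"
    have ab: "a \<in> D8_mats" "b \<in> D8_mats" "mat_map a \<in> ?gen" "mat_map b \<in> ?gen"
      unfolding a_def b_def by (auto intro!: mult gen rs D8_mats_mult)
    have "mat_map (mat_mult a a) \<in> ?gen" "mat_map (mat_mult ?r ?r) \<in> ?gen"
      "mat_map (mat_mult ?s b) \<in> ?gen" "mat_map (mat_mult a ?s) \<in> ?gen" "mat_map (mat_mult b ?s) \<in> ?gen"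
      "mat_map (mat_mult ?r b) \<in> ?gen"
      using mult gen rs ab by blast+
    then show ?thesis
      using M ab(3,4) gen unfolding D8_mats_def
      by (elim insertE emptyE; simp add: a_def b_def mat_mult_def vec_mat_def)
  qed
  ultimately show ?thesis unfolding D8 by blast
qed

lemma tensor_map_mat_map:
  fixes B :: "'f::field ^ 'm::finite \<Rightarrow> 'f ^ 'm"
  assumes B: "B \<in> GL"
  shows "tensor_map (mat_map M) B = kron M B"
proof -
  have lin: "Vector_Spaces.linear (*s) (*s) (mat_map M)" "Vector_Spaces.linear (*s) (*s) B"
    using B by (simp_all add: mat_map_def GL_def matrix_vector_mul_linear_gen)
  interpret A: Vector_Spaces.linear "(*s)" "(*s)" "mat_map M" by fact
  interpret B: Vector_Spaces.linear "(*s)" "(*s)" B by fact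
  have uniq: "\<exists>!T. Vector_Spaces.linear (*s) (*s) T \<and> (\<forall>v w. T (tensor v w) = tensor (mat_map M v) (B w))"
  proof (rule tensor_universal)
    show "Vector_Spaces.linear (*s) (*s) (\<lambda>v. tensor (mat_map M v) (B w))" for w
      by unfold_locales (simp_all add: A.add A.scale tensor_def vec_eq_iff algebra_simps)
    show "Vector_Spaces.linear (*s) (*s) (\<lambda>w. tensor (mat_map M v) (B w))" for v
      by unfold_locales (simp_all add: B.add B.scale tensor_def vec_eq_iff algebra_simps)
  qed
  have "form s (tensor v w) = (fst s * v $ 1 + snd s * v $ 2) *s w" for s v and w :: "'f ^ 'm"
    by (simp add: form_def tensor_def vec_eq_iff algebra_simps)
  moreover have "tensor_row i (tensor a b) = a $ i *s b" for i and a :: "'f ^ 2" and b :: "'f ^ 'm"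
    by (simp add: tensor_def vec_eq_iff)
  ultimately have "kron M B (tensor v w) = tensor (mat_map M v) (B w)" for v w
    by (intro stack_eqI) (simp_all add: kron_def B.scale)
  moreover have "Vector_Spaces.linear (*s) (*s) (kron M B)"
  proof unfold_locales
    show "kron M B (x + y) = kron M B x + kron M B y" for x y
      by (simp add: kron_def form_add B.add stack_add)
    have "form s (c *s x) = c *s form s x" for s c and x :: "'f ^ (2 \<times> 'm::finite)"
      by (simp add: form_def vec_eq_iff algebra_simps)
    then show "kron M B (c *s x) = c *s kron M B x" for c x
      by (intro stack_eqI) (simp_all add: kron_def B.scale)
  qed
  ultimately show ?thesis using uniq tensor_map[OF lin] by blast
qed

text \<open>
  The group in coordinates. All later arguments use this description in place of tensor maps.
\<close>

theorem G_group_eq: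
  "(G_group :: ('f::{field,finite} ^ (2 \<times> 'm::finite) \<Rightarrow> 'f ^ (2 \<times> 'm)) set) = {\<lambda>x. kron M B x + t | M B t. M \<in> D8_mats \<and> B \<in> GL}"
proof -
  have "central_product D8 GL = {kron M B | M B. M \<in> D8_mats \<and> (B :: 'f ^ 'm \<Rightarrow> 'f ^ 'm) \<in> GL}"
  proof (rule equalityI; rule subsetI)
    fix h :: "'f ^ (2 \<times> 'm) \<Rightarrow> 'f ^ (2 \<times> 'm)"
    assume "h \<in> central_product D8 GL"
    then obtain M B where "M \<in> D8_mats" "B \<in> GL" "h = tensor_map (mat_map M) B"
      by (auto simp: central_product_def D8_eq)
    then show "h \<in> {kron M B | M B. M \<in> D8_mats \<and> B \<in> GL}"
      using tensor_map_mat_map by blast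
  next
    fix h :: "'f ^ (2 \<times> 'm) \<Rightarrow> 'f ^ (2 \<times> 'm)"
    assume "h \<in> {kron M B | M B. M \<in> D8_mats \<and> B \<in> GL}"
    then obtain M B where MB: "M \<in> D8_mats" "B \<in> GL" "h = kron M B" by blast
    then have "h = tensor_map (mat_map M) B" by (simp add: tensor_map_mat_map)
    then show "h \<in> central_product D8 GL" using MB unfolding central_product_def D8_eq by blast
  qed
  note cp = this
  show ?thesis
  proof (rule equalityI; rule subsetI)
    fix g :: "'f ^ (2 \<times> 'm) \<Rightarrow> 'f ^ (2 \<times> 'm)"
    assume "g \<in> G_group"
    then obtain h t where "h \<in> central_product D8 GL" "g = (\<lambda>x. h x + t)"
      by (auto simp: G_group_def)
    then show "g \<in> {\<lambda>x. kron M B x + t | M B t. M \<in> D8_mats \<and> B \<in> GL}"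
      unfolding cp by blast
  next
    fix g :: "'f ^ (2 \<times> 'm) \<Rightarrow> 'f ^ (2 \<times> 'm)"
    assume "g \<in> {\<lambda>x. kron M B x + t | M B t. M \<in> D8_mats \<and> B \<in> GL}"
    then obtain M B t where "M \<in> D8_mats" "B \<in> GL" "g = (\<lambda>x. kron M B x + t)" by blast
    then show "g \<in> G_group" unfolding G_group_def cp by blast
  qed
qed

lemma kron_scale:
  "kron ((c * a, c * b), (c * a', c * b')) B = kron ((a, b), (a', b')) (\<lambda>u. B (c *s u))"
proof -
  have "form (c * a, c * b) x = c *s form (a, b) x" for a b and x :: "'a ^ (2 \<times> 'b)"
    by (simp add: form_def vec_eq_iff algebra_simps)
  then show ?thesis by (simp add: fun_eq_iff kron_def)
qed

lemma GL_scale: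
  fixes B :: "'f::field ^ 'm::finite \<Rightarrow> 'f ^ 'm"
  assumes B: "B \<in> GL" and c: "c \<noteq> 0"
  shows "(\<lambda>u. B (c *s u)) \<in> GL"
proof (rule GL_I)
  have "bij (\<lambda>u :: 'f ^ 'm. c *s u)"
    by (rule o_bij[of "\<lambda>u. inverse c *s u"]) (use c in \<open>auto simp: fun_eq_iff vec_eq_iff\<close>)
  then show "bij (\<lambda>u. B (c *s u))" using bij_comp[OF _ GL_bij[OF B]] by (auto simp: comp_def)
qed (simp_all add: GL_linear[OF B] vector_add_ldistrib vec.scale_left_commute mult.commute)

text \<open>
  Scalars can be moved from \<open>M\<close> into \<open>B\<close> in \<open>kron M B\<close>, so these are the matrices \<open>M\<close>
  that give elements of the group.
\<close>

definition scalar_D8 :: "'f::field mat2 \<Rightarrow> bool"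
  where "scalar_D8 M \<longleftrightarrow> (\<exists>c a b a' b'. c \<noteq> 0 \<and> ((a, b), (a', b')) \<in> D8_mats \<and>
    M = ((c * a, c * b), (c * a', c * b')))"

lemma kron_in_G_group:
  fixes B :: "'f::{field,finite} ^ 'm::finite \<Rightarrow> 'f ^ 'm"
  assumes "scalar_D8 M" "B \<in> GL"
  shows "(\<lambda>x. kron M B x + t) \<in> G_group"
proof -
  obtain c a b a' b' where c: "c \<noteq> 0" "((a, b), (a', b')) \<in> D8_mats" "M = ((c * a, c * b), (c * a', c * b'))"
    using assms(1) by (auto simp: scalar_D8_def)
  show ?thesis
    unfolding c(3) kron_scale G_group_eq
    using c(2) GL_scale[OF assms(2) c(1)] by blast
qed

section \<open>Prime fields and maps preserving three parallel classes\<close>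

lemma CHAR_prime_field:
  assumes "prime CARD('f::{field,finite})"
  shows "CHAR('f) = CARD('f)"
  using assms CHAR_dvd_CARD[where ?'a = 'f] CHAR_not_1'[where ?'a = 'f] prime_nat_iff
  by (metis One_nat_def)

lemma prime_field_of_nat:
  fixes c :: "'f::{field,finite}"
  assumes "prime CARD('f)"
  shows "\<exists>n<CARD('f). c = of_nat n"
proof -
  have "inj_on (of_nat :: nat \<Rightarrow> 'f) {..<CARD('f)}"
  proof (rule inj_onI)
    fix i j assume ij: "i \<in> {..<CARD('f)}" "j \<in> {..<CARD('f)}" "(of_nat i :: 'f) = of_nat j"
    then have "[i = j] (mod CARD('f))"
      using of_nat_eq_iff_cong_CHAR[where ?'a = 'f] CHAR_prime_field[OF assms] by simp
    then show "i = j" using ij by (simp add: cong_def)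
  qed
  then have "card (of_nat ` {..<CARD('f)} :: 'f set) = CARD('f)"
    by (simp add: card_image)
  then have "of_nat ` {..<CARD('f)} = (UNIV :: 'f set)"
    by (intro card_subset_eq) auto
  then show ?thesis by (metis UNIV_I imageE lessThan_iff)
qed

lemma of_int_eq_0_prime_field:
  assumes "prime CARD('f::{field,finite})"
  shows "(of_int k :: 'f) = 0 \<longleftrightarrow> int CARD('f) dvd k"
  using of_int_eq_iff_cong_CHAR[where ?'a = 'f, of k 0] CHAR_prime_field[OF assms]
  by (simp add: cong_0_iff)

text \<open>
  Here primality of the order of the field matters: every scalar is a multiple of \<open>1\<close>, so
  no field automorphisms occur.
\<close>

lemma additive_imp_linear_prime_field:
  fixes f :: "'f::{field,finite} ^ 'm::finite \<Rightarrow> 'f ^ 'm"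
  assumes "prime CARD('f)" and add: "\<And>u v. f (u + v) = f u + f v"
  shows "f (c *s u) = c *s f u"
proof -
  have "f 0 = 0" using add[of 0 0] by simp
  have "f (of_nat n *s u) = of_nat n *s f u" for n
  proof (induction n)
    case 0
    then show ?case using \<open>f 0 = 0\<close> by simp
  next
    case (Suc n)
    have "of_nat (Suc n) *s u = of_nat n *s u + u" for u :: "'f ^ 'm"
      by (simp add: vec_eq_iff algebra_simps)
    then show ?case using Suc add by simp
  qed
  then show ?thesis using prime_field_of_nat[OF assms(1), of c] by auto
qed

lemma exists_mat_with_images:
  assumes "det2 s t \<noteq> 0"
  shows "\<exists>M. vec_mat s M = a \<and> vec_mat t M = b"
proof -
  let ?D = "det2 s t"
  let ?M = "((snd t / ?D * fst a - snd s / ?D * fst b, snd t / ?D * snd a - snd s / ?D * snd b),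
             (fst s / ?D * fst b - fst t / ?D * fst a, fst s / ?D * snd b - fst t / ?D * snd a))"
  have eq: "?D = fst s * snd t - snd s * fst t" by (simp add: det2_def)
  have "vec_mat s ?M = a"
    using assms by (simp add: vec_mat_def prod_eq_iff field_simps) (simp add: eq algebra_simps)
  moreover have "vec_mat t ?M = b"
    using assms by (simp add: vec_mat_def prod_eq_iff field_simps) (simp add: eq algebra_simps)
  ultimately show ?thesis by blast
qed

lemma form_third:
  assumes "det2 s t \<noteq> 0"
  shows "form r x = (det2 r t / det2 s t) *s form s x + (det2 s r / det2 s t) *s form t x"
proof -
  have "fst r = (det2 r t / det2 s t) * fst s + (det2 s r / det2 s t) * fst t"
    "snd r = (det2 r t / det2 s t) * snd s + (det2 s r / det2 s t) * snd t"
    using assms by (simp_all add: field_simps) (simp_all add: det2_def algebra_simps)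
  then show ?thesis by (simp add: form_def vec_eq_iff algebra_simps)
qed

text \<open>
  After a translation \<open>g\<close> fixes \<open>0\<close>. Two of the three classes serve as coordinates, in which \<open>g\<close> acts by maps \<open>f1\<close>, \<open>f2\<close>
  on each coordinate separately; the third class gives a map \<open>B\<close> with
  \<open>B (l u + m v) = l' f1 u + m' f2 v\<close>. So \<open>f1\<close> and \<open>f2\<close> are multiples of \<open>B\<close>, and \<open>B\<close> is additive,
  hence linear. (For the multiplication table of the group \<open>W\<close> this is the fact that its
  autotopisms come from automorphisms.)
\<close>

theorem three_classes_affine:
  fixes g :: "'f::{field,finite} ^ (2 \<times> 'm::finite) \<Rightarrow> 'f ^ (2 \<times> 'm)"
  assumes prime: "prime CARD('f)" and g: "bij g"
    and s: "det2 s1 s2 \<noteq> 0" "det2 s1 s3 \<noteq> 0" "det2 s3 s2 \<noteq> 0"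
    and t: "det2 t1 t2 \<noteq> 0" "det2 t1 t3 \<noteq> 0" "det2 t3 t2 \<noteq> 0"
    and map: "\<And>x y. form s1 x = form s1 y \<Longrightarrow> form t1 (g x) = form t1 (g y)"
      "\<And>x y. form s2 x = form s2 y \<Longrightarrow> form t2 (g x) = form t2 (g y)"
      "\<And>x y. form s3 x = form s3 y \<Longrightarrow> form t3 (g x) = form t3 (g y)"
  shows "\<exists>M B b. det_mat M \<noteq> 0 \<and> B \<in> GL \<and> g = (\<lambda>x. kron M B x + b)"
proof -
  define k where "k x = g x - g 0" for x
  define z where "z u v = inv_into UNIV (\<lambda>x. (form s1 x, form s2 x)) (u, v)" for u v :: "'f ^ 'm"
  have z: "form s1 (z u v) = u" "form s2 (z u v) = v" for u v
    using surj_f_inv_f[OF bij_is_surj[OF bij_forms[OF s(1)]], of "(u, v)"] by (simp_all add: z_def)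
  have z0: "z 0 0 = 0" using form_eq_iff[OF s(1), of "z 0 0" 0] z by simp
  define l m l' m' where lm: "l = det2 s3 s2 / det2 s1 s2" "m = det2 s1 s3 / det2 s1 s2"
    "l' = det2 t3 t2 / det2 t1 t2" "m' = det2 t1 t3 / det2 t1 t2"
  have nz: "l \<noteq> 0" "m \<noteq> 0" "l' \<noteq> 0" "m' \<noteq> 0" using s t by (auto simp: lm)
  have s3: "form s3 x = l *s form s1 x + m *s form s2 x" for x :: "'f ^ (2 \<times> 'm)"
    unfolding lm by (rule form_third[OF s(1)])
  have t3: "form t3 x = l' *s form t1 x + m' *s form t2 x" for x :: "'f ^ (2 \<times> 'm)"
    unfolding lm by (rule form_third[OF t(1)])
  define f1 f2 B where "f1 u = form t1 (k (z u 0))" and "f2 v = form t2 (k (z 0 v))"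
    and "B w = form t3 (k (z (inverse l *s w) 0))" for u v w
  have f1: "form t1 (k x) = f1 (form s1 x)" for x
    unfolding f1_def k_def form_diff using map(1)[of x "z (form s1 x) 0"] z by simp
  have f2: "form t2 (k x) = f2 (form s2 x)" for x
    unfolding f2_def k_def form_diff using map(2)[of x "z 0 (form s2 x)"] z by simp
  have B: "form t3 (k x) = B (form s3 x)" for x
  proof -
    have "form s3 x = form s3 (z (inverse l *s form s3 x) 0)"
      using nz z by (simp add: s3[of "z _ _"])
    then show ?thesis unfolding B_def k_def form_diff using map(3) by metis
  qed
  have f0: "f1 0 = 0" "f2 0 = 0" by (simp_all add: f1_def f2_def z0 k_def)
  have eq: "B (l *s u + m *s v) = l' *s f1 u + m' *s f2 v" for u v
    using t3[of "k (z u v)"] f1[of "z u v"] f2[of "z u v"] B[of "z u v"] s3[of "z u v"] z by simp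
  have B1: "B u = l' *s f1 (inverse l *s u)" for u
    using eq[of "inverse l *s u" 0] nz f0 by simp
  have B2: "B u = m' *s f2 (inverse m *s u)" for u
    using eq[of 0 "inverse m *s u"] nz f0 by simp
  have add: "B (u + v) = B u + B v" for u v
    using eq[of "inverse l *s u" "inverse m *s v"] nz B1[of u] B2[of v] by simp
  have scale: "B (c *s u) = c *s B u" for c u
    by (rule additive_imp_linear_prime_field[OF prime add])
  have "surj B"
    unfolding surj_def
  proof
    fix w :: "'f ^ 'm"
    obtain y where y: "form t3 y = w"
      using surjD[OF bij_is_surj[OF bij_forms[OF t(2)]], of "(0, w)"] by auto
    obtain x where "g x = y + g 0" using bij_is_surj[OF g] by (metis surjD)
    then have "k x = y" by (simp add: k_def)
    then show "\<exists>u. w = B u" using B[of x] y by auto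
  qed
  then have "bij B" by (simp add: bij_def finite_UNIV_surj_inj)
  then have GL: "B \<in> GL" using add scale by (rule GL_I)
  obtain M where M: "vec_mat t1 M = (l / l' * fst s1, l / l' * snd s1)"
    "vec_mat t2 M = (m / m' * fst s2, m / m' * snd s2)"
    using exists_mat_with_images[OF t(1)] by blast
  have "det2 t1 t2 * det_mat M = (l / l') * (m / m') * det2 s1 s2"
    unfolding det2_vec_mat[symmetric] M by (simp add: det2_def algebra_simps)
  then have det: "det_mat M \<noteq> 0" using nz s t by auto
  have fs: "form (c * fst s, c * snd s) x = c *s form s x" for c s and x :: "'f ^ (2 \<times> 'm)"
    by (simp add: form_def vec_eq_iff algebra_simps)
  have "l' *s f1 u = l *s B u" "m' *s f2 u = m *s B u" for u
    using B1[of "l *s u"] B2[of "m *s u"] nz by (simp_all add: scale)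
  then have "inverse l' *s (l' *s f1 u) = inverse l' *s (l *s B u)"
    "inverse m' *s (m' *s f2 u) = inverse m' *s (m *s B u)" for u by simp_all
  then have f12: "f1 u = (l / l') *s B u" "f2 u = (m / m') *s B u" for u
    using nz by (simp_all add: divide_inverse mult.commute)
  have "form t1 (k x) = form t1 (kron M B x)" for x
    unfolding f1 f12 form_kron[OF GL] M fs scale ..
  moreover have "form t2 (k x) = form t2 (kron M B x)" for x
    unfolding f2 f12 form_kron[OF GL] M fs scale ..
  ultimately have "k x = kron M B x" for x using form_eq_iff[OF t(1)] by blast
  then have "g x = kron M B x + g 0" for x unfolding k_def by (rule iffD1[OF diff_eq_eq])
  then have "g = (\<lambda>x. kron M B x + g 0)" by (rule ext)
  then show ?thesis using det GL by blast
qed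

text \<open>
  If \<open>kron M B\<close> maps lines of direction \<open>s\<close> into lines of direction \<open>t\<close>, then \<open>t M\<close> and \<open>s\<close> are
  proportional: test on a difference of rank one that lies in the kernel of \<open>form s\<close>.
\<close>

lemma class_image_direction:
  fixes B :: "'f::{field,finite} ^ 'm::finite \<Rightarrow> 'f ^ 'm"
  assumes B: "B \<in> GL"
    and map: "\<And>x y. form s x = form s y \<Longrightarrow> form t (kron M B x + b) = form t (kron M B y + b)"
  shows "det2 (vec_mat t M) s = 0"
proof -
  let ?w = "axis undefined 1 :: 'f ^ 'm"
  let ?x = "stack (snd s *s ?w) (- fst s *s ?w)"
  have "form s ?x = form s 0" by (simp add: form_stack vec_eq_iff)
  from map[OF this] have "B (form (vec_mat t M) ?x) = B 0"
    by (simp add: form_add form_kron[OF B])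
  then have "form (vec_mat t M) ?x = 0" using GL_bij[OF B] by (simp add: bij_is_inj inj_eq)
  then have "form (vec_mat t M) ?x $ undefined = 0" by simp
  then show ?thesis by (simp add: form_stack det2_def algebra_simps)
qed

lemma vec_mat_mult: "vec_mat (vec_mat s M) N = vec_mat s (mat_mult M N)"
  by (simp add: vec_mat_def mat_mult_def algebra_simps)

lemma vec_mat_id [simp]: "vec_mat s ((1, 0), (0, 1)) = s"
  by (simp add: vec_mat_def)

lemma vec_mat_uminus: "vec_mat (- s) M = - vec_mat s M"
  by (simp add: vec_mat_def uminus_prod_def)

lemma form_uminus: "form (- s) x = - form s x"
  by (simp add: form_def vec_eq_iff)

text \<open>
  Proportionality up to sign is enough in all cases below; \<open>- 1\<close> does not change a direction.
\<close>

definition D8_invariant :: "('f::field \<times> 'f) set \<Rightarrow> bool"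
  where "D8_invariant R \<longleftrightarrow> (\<forall>M\<in>D8_mats. \<forall>s\<in>R. vec_mat s M \<in> R \<or> - vec_mat s M \<in> R)"

lemma det_D8_mats: "M \<in> D8_mats \<Longrightarrow> det_mat M \<noteq> 0"
  unfolding D8_mats_def by (elim insertE emptyE; simp add: det_mat_def det2_def)

lemma G_group_subset_Aut:
  fixes R :: "('f::{field,finite} \<times> 'f) set"
  assumes R: "D8_invariant R"
  shows "(G_group :: ('f ^ (2 \<times> 'm::finite) \<Rightarrow> 'f ^ (2 \<times> 'm)) set) \<subseteq> digraph_Aut (net_arcs R form)"
proof
  fix g :: "'f ^ (2 \<times> 'm) \<Rightarrow> 'f ^ (2 \<times> 'm)" assume "g \<in> G_group"
  then obtain M B b where MB: "M \<in> D8_mats" "B \<in> GL" and g: "g = (\<lambda>x. kron M B x + b)"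
    unfolding G_group_eq by blast
  have "bij (kron M B)" using bij_kron MB det_D8_mats by blast
  then have bij: "bij g" using bij_comp[OF _ bij_plus_right[of b]] unfolding g by (simp add: comp_def)
  have eq: "form s (g x) = form s (g y) \<longleftrightarrow> form (vec_mat s M) x = form (vec_mat s M) y" for s x y
    using GL_bij[OF MB(2)] by (simp add: g form_add form_kron[OF MB(2)] bij_is_inj inj_eq)
  have arcs: "(\<exists>s\<in>R. form s x = form s y) \<longleftrightarrow> (\<exists>s\<in>R. form s (g x) = form s (g y))" for x y
  proof
    assume "\<exists>s\<in>R. form s x = form s y"
    then obtain s where s: "s \<in> R" "form s x = form s y" by blast
    obtain N where N: "N \<in> D8_mats" "mat_mult N M = ((1, 0), (0, 1))" using D8_mats_inverse[OF MB(1)] by blast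
    have "form (vec_mat s N) (g x) = form (vec_mat s N) (g y)"
      unfolding eq vec_mat_mult N by (simp add: s)
    moreover from this have "form (- vec_mat s N) (g x) = form (- vec_mat s N) (g y)"
      by (simp add: form_uminus)
    ultimately show "\<exists>s\<in>R. form s (g x) = form s (g y)"
      using R s N unfolding D8_invariant_def by blast
  next
    assume "\<exists>s\<in>R. form s (g x) = form s (g y)"
    then obtain s where s: "s \<in> R" "form (vec_mat s M) x = form (vec_mat s M) y" by (auto simp: eq)
    moreover from this have "form (- vec_mat s M) x = form (- vec_mat s M) y"
      by (simp add: form_uminus)
    ultimately show "\<exists>s\<in>R. form s x = form s y"
      using R MB unfolding D8_invariant_def by blast
  qed
  have "g x = g y \<longleftrightarrow> x = y" for x y using bij by (simp add: bij_is_inj inj_eq)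
  then show "g \<in> digraph_Aut (net_arcs R form)"
    by (simp add: digraph_Aut_def net_arcs_def bij arcs[symmetric])
qed

text \<open>
  The bound \<open>card R \<le> CARD('f)\<close> is what makes lines recognisable: a line has
  \<open>CARD('f) ^ CARD('m)\<close> points, and this exceeds \<open>(card R - 1)\<^sup>2\<close> since \<open>W\<close> has dimension at least two.
\<close>

lemma Aut_permutes_directions:
  fixes R :: "('f::{field,finite} \<times> 'f) set"
  assumes "finite R" "card R \<ge> 2"
    and "\<And>s t. s \<in> R \<Longrightarrow> t \<in> R \<Longrightarrow> s \<noteq> t \<Longrightarrow> det2 s t \<noteq> 0"
    and "card R \<le> CARD('f)"
    and "g \<in> digraph_Aut (net_arcs R form :: (('f ^ (2 \<times> 'm::finite)) \<times> ('f ^ (2 \<times> 'm))) set)"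
    and "CARD('m) \<ge> 2"
  shows "\<exists>\<sigma>. \<sigma> ` R \<subseteq> R \<and> inj_on \<sigma> R \<and>
    (\<forall>s\<in>R. \<forall>x y. form s x = form s y \<longrightarrow> form (\<sigma> s) (g x) = form (\<sigma> s) (g y))"
proof -
  have "(card R - 1)\<^sup>2 < CARD('f)\<^sup>2"
    using assms(2,4) by (intro power_strict_mono) auto
  also have "\<dots> \<le> CARD('f) ^ CARD('m)"
    using assms(6) by (intro power_increasing) (auto simp: Suc_le_eq)
  finally have "(card R - 1)\<^sup>2 < CARD('f ^ 'm)" by simp
  from net_automorphism_permutes_classes[where \<phi> = form, OF assms(1,2) bij_forms this assms(5)]
  show ?thesis using assms(3) by blast
qed

section \<open>The group as an intersection of automorphism groups\<close>

lemma permutation_group_digraph_Aut: "permutation_group (digraph_Aut E)"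
  unfolding permutation_group_iff
proof (intro conjI ballI)
  fix g assume g: "g \<in> digraph_Aut E"
  then have "bij g" by (simp add: digraph_Aut_def)
  then have inv: "g (inv_into UNIV g u) = u" for u by (simp add: bij_is_surj surj_f_inv_f)
  have "(u, v) \<in> E \<longleftrightarrow> (inv_into UNIV g u, inv_into UNIV g v) \<in> E" for u v
  proof -
    have "(inv_into UNIV g u, inv_into UNIV g v) \<in> E \<longleftrightarrow>
        (g (inv_into UNIV g u), g (inv_into UNIV g v)) \<in> E"
      using g unfolding digraph_Aut_def by blast
    then show ?thesis by (simp add: inv)
  qed
  then show "inv_into UNIV g \<in> digraph_Aut E"
    using \<open>bij g\<close> by (simp add: digraph_Aut_def bij_imp_bij_inv)
qed (auto simp: digraph_Aut_def intro: bij_comp)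

lemma permutation_group_Int:
  "permutation_group G \<Longrightarrow> permutation_group H \<Longrightarrow> permutation_group (G \<inter> H)"
  unfolding permutation_group_iff by simp

text \<open>
  A permutation that preserves the orbitals of a group moves each single pair as some element of the group
  does, so it preserves every arc set that the group preserves.
\<close>

lemma two_closed_Int_digraph_Aut:
  "two_closed (digraph_Aut E \<inter> digraph_Aut E')"
proof -
  let ?G = "digraph_Aut E \<inter> digraph_Aut E'"
  have G: "permutation_group ?G"
    by (intro permutation_group_Int permutation_group_digraph_Aut)
  have "g \<in> ?G" if g: "bij g" "\<And>D. D \<in> orbitals ?G \<Longrightarrow> map_prod g g ` D = D" for g
  proof -
    have "\<exists>h\<in>?G. (g u, g v) = (h u, h v)" for u v
    proof -
      let ?D = "{(h u, h v) | h. h \<in> ?G}"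
      have D: "?D \<in> orbitals ?G" unfolding orbitals_eq by blast
      have "id \<in> ?G" using G unfolding permutation_group_iff by blast
      then have "(u, v) \<in> ?D" by (intro CollectI exI[of _ id]) simp
      then have "map_prod g g (u, v) \<in> map_prod g g ` ?D" by (rule imageI)
      then have "(g u, g v) \<in> ?D" using g(2)[OF D] by simp
      then show ?thesis by blast
    qed
    then have "((u, v) \<in> E \<longleftrightarrow> (g u, g v) \<in> E) \<and> ((u, v) \<in> E' \<longleftrightarrow> (g u, g v) \<in> E')" for u v
      unfolding digraph_Aut_def by (metis (mono_tags, lifting) IntD1 IntD2 mem_Collect_eq)
    then show ?thesis using g(1) by (simp add: digraph_Aut_def)
  qed
  moreover have "g \<in> two_closure ?G" if "g \<in> ?G" for g
  proof -
    have bij: "bij g" using that by (simp add: digraph_Aut_def)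
    have "map_prod g g ` {(h a, h b) | h. h \<in> ?G} = {(h a, h b) | h. h \<in> ?G}" for a b
    proof (rule equalityI; rule subsetI)
      fix x assume "x \<in> map_prod g g ` {(h a, h b) | h. h \<in> ?G}"
      then obtain h where "h \<in> ?G" "x = ((g \<circ> h) a, (g \<circ> h) b)" by auto
      moreover from this have "g \<circ> h \<in> ?G" using G that unfolding permutation_group_iff by blast
      ultimately show "x \<in> {(h a, h b) | h. h \<in> ?G}" by blast
    next
      fix x assume "x \<in> {(h a, h b) | h. h \<in> ?G}"
      then obtain h where h: "h \<in> ?G" "x = (h a, h b)" by auto
      define k where "k = inv_into UNIV g \<circ> h"
      have "k \<in> ?G" using G that h(1) unfolding permutation_group_iff k_def by blast
      moreover have "x = map_prod g g (k a, k b)"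
        using bij h(2) by (simp add: k_def bij_is_surj surj_f_inv_f)
      ultimately show "x \<in> map_prod g g ` {(h a, h b) | h. h \<in> ?G}" by blast
    qed
    note image = this
    have "map_prod g g ` D = D" if D: "D \<in> orbitals ?G" for D
    proof -
      obtain a b where "D = {(h a, h b) | h. h \<in> ?G}" using D unfolding orbitals_eq by blast
      then show ?thesis by (simp only: image)
    qed
    then show ?thesis using bij unfolding two_closure_eq[OF G] by blast
  qed
  moreover have "bij g" "\<And>D. D \<in> orbitals ?G \<Longrightarrow> map_prod g g ` D = D" if "g \<in> two_closure ?G" for g
    using that unfolding two_closure_eq[OF G] by blast+
  ultimately have "two_closure ?G = ?G" by (intro equalityI subsetI) metis+
  then show ?thesis using G unfolding two_closed_def by blast
qed

lemma scalar_D8_I: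
  "c \<noteq> 0 \<Longrightarrow> ((a, b), (a', b')) \<in> D8_mats \<Longrightarrow> M = ((c * a, c * b), (c * a', c * b')) \<Longrightarrow> scalar_D8 M"
  unfolding scalar_D8_def by blast

lemma one_neq_minus_one:
  assumes "prime CARD('f::{field,finite})" "odd CARD('f)"
  shows "(1 :: 'f) \<noteq> - 1" "(2 :: 'f) \<noteq> 0"
proof -
  have "\<not> int CARD('f) dvd 2"
    using assms by (metis dvd_refl even_numeral int_dvd_int_iff of_nat_numeral prime_ge_2_nat
        dvd_imp_le le_antisym zero_less_numeral)
  then have "of_int 2 \<noteq> (0 :: 'f)" using of_int_eq_0_prime_field[OF assms(1)] by blast
  then show two: "(2 :: 'f) \<noteq> 0" by simp
  show "(1 :: 'f) \<noteq> - 1"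
  proof
    assume "(1 :: 'f) = - 1"
    then have "(2 :: 'f) = 0" by (metis add.right_inverse one_add_one)
    then show False using two by simp
  qed
qed

definition axis_dirs :: "('f::field \<times> 'f) set"
  where "axis_dirs = {(1, 0), (0, 1)}"

definition diagonal_dirs :: "('f::field \<times> 'f) set"
  where "diagonal_dirs = {(1, 1), (1, -1)}"

lemma D8_invariant_axis_dirs: "D8_invariant axis_dirs"
  unfolding D8_invariant_def D8_mats_def axis_dirs_def
  by (intro ballI; elim insertE emptyE; simp add: vec_mat_def)

lemma D8_invariant_diagonal_dirs: "D8_invariant diagonal_dirs"
  unfolding D8_invariant_def D8_mats_def diagonal_dirs_def
  by (intro ballI; elim insertE emptyE; simp add: vec_mat_def)

text \<open>
  A common automorphism of the two graphs permutes the two axis directions and the two diagonal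
  directions. Three of these four directions make it affine, say \<open>kron M B + b\<close>. As \<open>M\<close> permutes the axis
  directions it is monomial, and as it permutes the diagonal ones its two entries agree up to sign.
\<close>

theorem G_group_eq_Int_Aut:
  assumes prime: "prime CARD('f::{field,finite})" and odd: "odd CARD('f)" and m: "CARD('m::finite) \<ge> 2"
  shows "(G_group :: ('f ^ (2 \<times> 'm) \<Rightarrow> 'f ^ (2 \<times> 'm)) set) =
    digraph_Aut (net_arcs axis_dirs form) \<inter> digraph_Aut (net_arcs diagonal_dirs form)"
proof (rule equalityI)
  show "(G_group :: ('f ^ (2 \<times> 'm) \<Rightarrow> 'f ^ (2 \<times> 'm)) set) \<subseteq>
    digraph_Aut (net_arcs axis_dirs form) \<inter> digraph_Aut (net_arcs diagonal_dirs form)"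
    using G_group_subset_Aut[OF D8_invariant_axis_dirs] G_group_subset_Aut[OF D8_invariant_diagonal_dirs]
    by blast
next
  note neq = one_neq_minus_one[OF prime odd]
  have card: "2 \<le> CARD('f)" using prime by (rule prime_ge_2_nat)
  show "digraph_Aut (net_arcs axis_dirs form) \<inter> digraph_Aut (net_arcs diagonal_dirs form) \<subseteq>
    (G_group :: ('f ^ (2 \<times> 'm) \<Rightarrow> 'f ^ (2 \<times> 'm)) set)"
  proof
    fix g :: "'f ^ (2 \<times> 'm) \<Rightarrow> 'f ^ (2 \<times> 'm)"
    assume g: "g \<in> digraph_Aut (net_arcs axis_dirs form) \<inter> digraph_Aut (net_arcs diagonal_dirs form)"
    then have bij: "bij g" by (simp add: digraph_Aut_def)
    have axis: "finite (axis_dirs :: ('f \<times> 'f) set)" "2 \<le> card (axis_dirs :: ('f \<times> 'f) set)"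
      "card (axis_dirs :: ('f \<times> 'f) set) \<le> CARD('f)"
      "\<And>s t :: 'f \<times> 'f. s \<in> axis_dirs \<Longrightarrow> t \<in> axis_dirs \<Longrightarrow> s \<noteq> t \<Longrightarrow> det2 s t \<noteq> 0"
      using card by (auto simp: axis_dirs_def det2_def)
    have diagonal: "finite (diagonal_dirs :: ('f \<times> 'f) set)" "2 \<le> card (diagonal_dirs :: ('f \<times> 'f) set)"
      "card (diagonal_dirs :: ('f \<times> 'f) set) \<le> CARD('f)"
      "\<And>s t :: 'f \<times> 'f. s \<in> diagonal_dirs \<Longrightarrow> t \<in> diagonal_dirs \<Longrightarrow> s \<noteq> t \<Longrightarrow> det2 s t \<noteq> 0"
      using card neq by (auto simp: diagonal_dirs_def det2_def)
    obtain \<sigma> where \<sigma>: "\<sigma> ` axis_dirs \<subseteq> axis_dirs" "inj_on \<sigma> axis_dirs"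
      "\<And>s x y. s \<in> axis_dirs \<Longrightarrow> form s x = form s y \<Longrightarrow> form (\<sigma> s) (g x) = form (\<sigma> s) (g y)"
      using Aut_permutes_directions[OF axis(1,2,4,3), of g] g m by blast
    obtain \<tau> where \<tau>: "\<tau> ` diagonal_dirs \<subseteq> diagonal_dirs" "inj_on \<tau> diagonal_dirs"
      "\<And>s x y. s \<in> diagonal_dirs \<Longrightarrow> form s x = form s y \<Longrightarrow> form (\<tau> s) (g x) = form (\<tau> s) (g y)"
      using Aut_permutes_directions[OF diagonal(1,2,4,3), of g] g m by blast
    have s: "\<sigma> (1, 0) = (1, 0) \<and> \<sigma> (0, 1) = (0, 1) \<or> \<sigma> (1, 0) = (0, 1) \<and> \<sigma> (0, 1) = (1, 0)"
      using \<sigma>(1,2) by (auto simp: axis_dirs_def)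
    have t: "\<tau> (1, 1) = (1, 1) \<or> \<tau> (1, 1) = (1, -1)"
      using \<tau>(1) by (auto simp: diagonal_dirs_def)
    have mem: "(1, 0) \<in> axis_dirs" "(0, 1) \<in> axis_dirs" "(1, 1) \<in> diagonal_dirs"
      by (auto simp: axis_dirs_def diagonal_dirs_def)
    have dets: "det2 (\<sigma> (1, 0)) (\<sigma> (0, 1)) \<noteq> 0" "det2 (\<sigma> (1, 0)) (\<tau> (1, 1)) \<noteq> 0"
      "det2 (\<tau> (1, 1)) (\<sigma> (0, 1)) \<noteq> 0"
      using s t by (auto simp: det2_def)
    have "\<exists>M B b. det_mat M \<noteq> 0 \<and> B \<in> GL \<and> g = (\<lambda>x. kron M B x + b)"
      by (rule three_classes_affine[OF prime bij _ _ _ dets \<sigma>(3)[OF mem(1)] \<sigma>(3)[OF mem(2)] \<tau>(3)[OF mem(3)]])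
        (simp_all add: det2_def)
    then obtain M B b where M: "det_mat M \<noteq> 0" and B: "B \<in> GL" and g_eq: "g = (\<lambda>x. kron M B x + b)"
      by blast
    have dir: "det2 (vec_mat (\<sigma> (1, 0)) M) (1, 0) = 0"
      by (rule class_image_direction[OF B \<sigma>(3)[OF mem(1), unfolded g_eq]])
    have dir': "det2 (vec_mat (\<sigma> (0, 1)) M) (0, 1) = 0"
      by (rule class_image_direction[OF B \<sigma>(3)[OF mem(2), unfolded g_eq]])
    have dir'': "det2 (vec_mat (\<tau> (1, 1)) M) (1, 1) = 0"
      by (rule class_image_direction[OF B \<tau>(3)[OF mem(3), unfolded g_eq]])
    obtain a b c d where M_eq: "M = ((a, b), (c, d))" by (metis prod.collapse)
    have "scalar_D8 M"
      using s
    proof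
      assume s: "\<sigma> (1, 0) = (1, 0) \<and> \<sigma> (0, 1) = (0, 1)"
      then have "b = 0" "c = 0" "d = a \<or> d = - a" "a \<noteq> 0"
        using dir dir' dir'' t M by (auto simp: M_eq det2_def vec_mat_def det_mat_def eq_neg_iff_add_eq_0 add.commute)
      then show ?thesis
        using scalar_D8_I[of a 1 0 0 1 M] scalar_D8_I[of a 1 0 0 "-1" M]
        by (auto simp: D8_mats_def M_eq)
    next
      assume s: "\<sigma> (1, 0) = (0, 1) \<and> \<sigma> (0, 1) = (1, 0)"
      then have "a = 0" "d = 0" "c = b \<or> c = - b" "b \<noteq> 0"
        using dir dir' dir'' t M by (auto simp: M_eq det2_def vec_mat_def det_mat_def eq_neg_iff_add_eq_0 add.commute)
      then show ?thesis
        using scalar_D8_I[of b 0 1 1 0 M] scalar_D8_I[of b 0 1 "-1" 0 M]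
        by (auto simp: D8_mats_def M_eq)
    qed
    then show "g \<in> G_group" unfolding g_eq using kron_in_G_group B by blast
  qed
qed

lemma not_regular_G_group:
  assumes prime: "prime CARD('f::{field,finite})" and odd: "odd CARD('f)"
  shows "\<not> regular_group (G_group :: ('f ^ (2 \<times> 'm::finite) \<Rightarrow> 'f ^ (2 \<times> 'm)) set)"
proof
  let ?n = "kron ((-1, 0), (0, -1)) id :: 'f ^ (2 \<times> 'm) \<Rightarrow> 'f ^ (2 \<times> 'm)"
  assume reg: "regular_group (G_group :: ('f ^ (2 \<times> 'm) \<Rightarrow> 'f ^ (2 \<times> 'm)) set)"
  have "id \<in> (GL :: ('f ^ 'm \<Rightarrow> 'f ^ 'm) set)" by (rule GL_I) auto
  moreover have "((-1, 0), (0, -1)) \<in> (D8_mats :: 'f mat2 set)" by (simp add: D8_mats_def)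
  ultimately have "(\<lambda>x. ?n x + 0) \<in> G_group" unfolding G_group_eq by blast
  then have n: "?n \<in> G_group" by simp
  have "?n 0 = 0" by (simp add: kron_def)
  then have "?n \<in> stabilizer (as_group G_group) (\<lambda>g. g) 0" using n by (simp add: stabilizer_def)
  then have "?n = id" using reg by (simp add: regular_group_def)
  then have "?n (stack u 0) = stack u 0" for u by (metis id_apply)
  moreover have "?n (stack u 0) = stack (- u) 0" for u by (simp add: kron_def form_stack)
  ultimately have "- axis undefined 1 = (axis undefined 1 :: 'f ^ 'm)" by (metis stack_inject)
  then have "(- axis undefined 1 :: 'f ^ 'm) $ undefined = (axis undefined 1 :: 'f ^ 'm) $ undefined" by (rule arg_cong[where f = "\<lambda>v. v $ undefined"])
  then have "- 1 = (1 :: 'f)" by (simp only: vector_uminus_component axis_nth)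
  then show False using one_neq_minus_one(1)[OF prime odd] by simp
qed

section \<open>Rigid sets of directions and cross-ratios\<close>

text \<open>
  The graph of a set \<open>R\<close> of directions has no automorphisms outside the group as soon as no matrix
  outside the scalar multiples of \<open>D8\<close> permutes \<open>R\<close>. The assumption \<open>rigid\<close> says this with \<open>\<sigma>\<close> the
  permutation of \<open>R\<close> inverse to the one induced by \<open>M\<close>.
\<close>

theorem Aut_net_eq_G_group:
  fixes R :: "('f::{field,finite} \<times> 'f) set"
  assumes prime: "prime CARD('f)" and m: "CARD('m::finite) \<ge> 2"
    and R: "finite R" "card R \<le> CARD('f)" "D8_invariant R"
    and indep: "\<And>s t. s \<in> R \<Longrightarrow> t \<in> R \<Longrightarrow> s \<noteq> t \<Longrightarrow> det2 s t \<noteq> 0"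
    and three: "r1 \<in> R" "r2 \<in> R" "r3 \<in> R" "r1 \<noteq> r2" "r1 \<noteq> r3" "r2 \<noteq> r3"
    and rigid: "\<And>M \<sigma>. det_mat M \<noteq> 0 \<Longrightarrow> \<sigma> ` R \<subseteq> R \<Longrightarrow> inj_on \<sigma> R \<Longrightarrow>
      (\<And>s. s \<in> R \<Longrightarrow> det2 (vec_mat (\<sigma> s) M) s = 0) \<Longrightarrow> scalar_D8 M"
  shows "digraph_Aut (net_arcs R form) = (G_group :: ('f ^ (2 \<times> 'm) \<Rightarrow> 'f ^ (2 \<times> 'm)) set)"
proof (rule equalityI)
  show "(G_group :: ('f ^ (2 \<times> 'm) \<Rightarrow> 'f ^ (2 \<times> 'm)) set) \<subseteq> digraph_Aut (net_arcs R form)"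
    by (rule G_group_subset_Aut[OF R(3)])
  show "digraph_Aut (net_arcs R form) \<subseteq> (G_group :: ('f ^ (2 \<times> 'm) \<Rightarrow> 'f ^ (2 \<times> 'm)) set)"
  proof
    fix g :: "'f ^ (2 \<times> 'm) \<Rightarrow> 'f ^ (2 \<times> 'm)"
    assume g: "g \<in> digraph_Aut (net_arcs R form)"
    then have bij: "bij g" by (simp add: digraph_Aut_def)
    have "card {r1, r2} \<le> card R" using three R by (intro card_mono) auto
    then have card: "2 \<le> card R" using three by simp
    obtain \<sigma> where \<sigma>: "\<sigma> ` R \<subseteq> R" "inj_on \<sigma> R"
      "\<And>s x y. s \<in> R \<Longrightarrow> form s x = form s y \<Longrightarrow> form (\<sigma> s) (g x) = form (\<sigma> s) (g y)"
      using Aut_permutes_directions[OF R(1) card indep R(2) g m] by blast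
    have ne: "\<sigma> r1 \<noteq> \<sigma> r2" "\<sigma> r1 \<noteq> \<sigma> r3" "\<sigma> r3 \<noteq> \<sigma> r2"
      using inj_onD[OF \<sigma>(2)] three by metis+
    have mem: "\<sigma> r1 \<in> R" "\<sigma> r2 \<in> R" "\<sigma> r3 \<in> R" using \<sigma>(1) three by auto
    obtain M B b where M: "det_mat M \<noteq> 0" and B: "B \<in> GL" and g_eq: "g = (\<lambda>x. kron M B x + b)"
      using three_classes_affine[OF prime bij
          indep[OF three(1,2,4)] indep[OF three(1,3,5)] indep[OF three(3,2) three(6)[symmetric]]
          indep[OF mem(1,2) ne(1)] indep[OF mem(1,3) ne(2)] indep[OF mem(3,2) ne(3)]
          \<sigma>(3)[OF three(1)] \<sigma>(3)[OF three(2)] \<sigma>(3)[OF three(3)]] by blast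
    have "scalar_D8 M"
    proof (rule rigid[OF M \<sigma>(1,2)])
      fix s assume "s \<in> R"
      show "det2 (vec_mat (\<sigma> s) M) s = 0"
        by (rule class_image_direction[OF B \<sigma>(3)[OF \<open>s \<in> R\<close>, unfolded g_eq]])
    qed
    then show "g \<in> G_group" unfolding g_eq using kron_in_G_group B by blast
  qed
qed

lemma det2_eq_0_imp_multiple:
  assumes "det2 a s = 0" "s \<noteq> 0"
  shows "\<exists>c. a = (c * fst s, c * snd s)"
proof (cases "fst s = 0")
  case True
  then have "snd s \<noteq> 0" using assms(2) by (simp add: prod_eq_iff)
  then show ?thesis using assms(1) True
    by (intro exI[of _ "snd a / snd s"]) (simp add: prod_eq_iff det2_def)
next
  case False
  then show ?thesis using assms(1)
    by (intro exI[of _ "fst a / fst s"]) (simp add: prod_eq_iff det2_def field_simps)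
qed

lemma det2_neq_0D: "det2 s t \<noteq> 0 \<Longrightarrow> s \<noteq> 0 \<and> t \<noteq> 0"
  by (auto simp: det2_def)

lemma det2_scale: "det2 (c * fst s, c * snd s) (d * fst t, d * snd t) = c * d * det2 s t"
  by (simp add: det2_def algebra_simps)

text \<open>
  The cross-ratio \<open>(u, v; w, z)\<close> is a projective invariant; denominators are cleared.
\<close>

lemma cross_ratio_preserved:
  assumes M: "det_mat M \<noteq> 0" and nz: "u \<noteq> 0" "v \<noteq> 0" "w \<noteq> 0" "z \<noteq> 0"
    and "det2 (vec_mat u' M) u = 0" "det2 (vec_mat v' M) v = 0"
      "det2 (vec_mat w' M) w = 0" "det2 (vec_mat z' M) z = 0"
  shows "det2 u' w' * det2 v' z' * (det2 v w * det2 u z) = det2 v' w' * det2 u' z' * (det2 u w * det2 v z)"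
proof -
  obtain cu cv cw cz where c: "vec_mat u' M = (cu * fst u, cu * snd u)" "vec_mat v' M = (cv * fst v, cv * snd v)"
    "vec_mat w' M = (cw * fst w, cw * snd w)" "vec_mat z' M = (cz * fst z, cz * snd z)"
    using assms det2_eq_0_imp_multiple by metis
  let ?D = "det_mat M"
  have d: "det2 u' w' * ?D = cu * cw * det2 u w" "det2 v' z' * ?D = cv * cz * det2 v z"
    "det2 v' w' * ?D = cv * cw * det2 v w" "det2 u' z' * ?D = cu * cz * det2 u z"
    unfolding det2_vec_mat[symmetric] c det2_scale by simp_all
  have "(det2 u' w' * det2 v' z' * (det2 v w * det2 u z)) * (?D * ?D) =
    (det2 u' w' * ?D) * (det2 v' z' * ?D) * (det2 v w * det2 u z)" by (simp add: ac_simps)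
  also have "\<dots> = (det2 v' w' * ?D) * (det2 u' z' * ?D) * (det2 u w * det2 v z)"
    unfolding d by (simp add: ac_simps)
  also have "\<dots> = (det2 v' w' * det2 u' z' * (det2 u w * det2 v z)) * (?D * ?D)" by (simp add: ac_simps)
  finally show ?thesis using M by simp
qed

lemma vec_mat_eq_imp_eq:
  assumes D: "det2 s t \<noteq> 0" and "vec_mat s M = vec_mat s N" "vec_mat t M = vec_mat t N"
  shows "M = N"
proof -
  have zero: "x = 0 \<and> y = 0" if "fst s * x + snd s * y = 0" "fst t * x + snd t * y = 0" for x y
  proof -
    have eq: "det2 s t * x = snd t * (fst s * x + snd s * y) - snd s * (fst t * x + snd t * y)"
      "det2 s t * y = fst s * (fst t * x + snd t * y) - fst t * (fst s * x + snd s * y)"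
      by (simp_all add: det2_def algebra_simps)
    have "det2 s t * x = 0" "det2 s t * y = 0"
      unfolding eq by (simp_all only: that mult_zero_right diff_self)
    then show ?thesis using D by simp
  qed
  have "fst (fst M) - fst (fst N) = 0 \<and> fst (snd M) - fst (snd N) = 0"
    by (rule zero) (use assms(2,3) in \<open>auto simp: vec_mat_def algebra_simps\<close>)
  moreover have "snd (fst M) - snd (fst N) = 0 \<and> snd (snd M) - snd (snd N) = 0"
    by (rule zero) (use assms(2,3) in \<open>auto simp: vec_mat_def algebra_simps\<close>)
  ultimately show ?thesis by (simp add: prod_eq_iff)
qed

lemma fixes_three_directions_imp_scalar:
  assumes M: "det_mat M \<noteq> 0"
    and D: "det2 s t \<noteq> 0" "det2 s r \<noteq> 0" "det2 r t \<noteq> 0"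
    and fix3: "det2 (vec_mat s M) s = 0" "det2 (vec_mat t M) t = 0" "det2 (vec_mat r M) r = 0"
  shows "\<exists>c. c \<noteq> 0 \<and> M = ((c, 0), (0, c))"
proof -
  have "s \<noteq> 0" "t \<noteq> 0" "r \<noteq> 0" using D det2_neq_0D by blast+
  then obtain a b c where abc: "vec_mat s M = (a * fst s, a * snd s)" "vec_mat t M = (b * fst t, b * snd t)"
    "vec_mat r M = (c * fst r, c * snd r)" using fix3 det2_eq_0_imp_multiple by metis
  have "det2 s r * det_mat M = a * c * det2 s r" "det2 r t * det_mat M = c * b * det2 r t"
    unfolding det2_vec_mat[symmetric] abc det2_scale by simp_all
  then have "det_mat M = a * c" "det_mat M = c * b" using D by auto
  then have "a = b" "a \<noteq> 0" using M by auto
  have "M = ((a, 0), (0, a))"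
    by (rule vec_mat_eq_imp_eq[OF D(1)]) (simp_all add: abc \<open>a = b\<close>, simp_all add: vec_mat_def mult.commute)
  then show ?thesis using \<open>a \<noteq> 0\<close> by blast
qed

lemma det_mat_mult: "det_mat (mat_mult M N) = det_mat M * det_mat N"
  by (simp add: det_mat_def mat_mult_def det2_vec_mat)

lemma mat_mult_assoc: "mat_mult (mat_mult L M) N = mat_mult L (mat_mult M N)"
  by (simp add: mat_mult_def vec_mat_mult)

text \<open>
  If \<open>M\<close> moves three directions back in the way that \<open>N\<close> moved them forth, then \<open>N M\<close> fixes three directions
  and is a scalar.
\<close>

lemma agrees_with_D8_imp_scalar_D8:
  assumes M: "det_mat M \<noteq> 0" and N: "N \<in> D8_mats"
    and D: "det2 s t \<noteq> 0" "det2 s r \<noteq> 0" "det2 r t \<noteq> 0"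
    and img: "s' = vec_mat s N \<or> s' = - vec_mat s N" "t' = vec_mat t N \<or> t' = - vec_mat t N"
      "r' = vec_mat r N \<or> r' = - vec_mat r N"
    and dir: "det2 (vec_mat s' M) s = 0" "det2 (vec_mat t' M) t = 0" "det2 (vec_mat r' M) r = 0"
  shows "scalar_D8 M"
proof -
  have neg: "det2 (- a) b = - det2 a b" for a b :: "'a \<times> 'a" by (simp add: det2_def)
  have "det2 (vec_mat s (mat_mult N M)) s = 0" "det2 (vec_mat t (mat_mult N M)) t = 0"
    "det2 (vec_mat r (mat_mult N M)) r = 0"
    using img dir by (auto simp: vec_mat_mult[symmetric] vec_mat_uminus neg)
  moreover have "det_mat (mat_mult N M) \<noteq> 0"
    using M det_D8_mats[OF N] by (simp add: det_mat_mult)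
  ultimately obtain c where c: "c \<noteq> 0" "mat_mult N M = ((c, 0), (0, c))"
    using fixes_three_directions_imp_scalar[OF _ D] by blast
  obtain L where L: "L \<in> D8_mats" "mat_mult L N = ((1, 0), (0, 1))" using D8_mats_inverse[OF N] by blast
  obtain a b a' b' where L_eq: "L = ((a, b), (a', b'))" by (metis prod.collapse)
  have "M = mat_mult ((1, 0), (0, 1)) M" by (simp add: mat_mult_def vec_mat_def)
  also have "\<dots> = mat_mult L (mat_mult N M)" by (simp only: L(2)[symmetric] mat_mult_assoc)
  also have "\<dots> = ((c * a, c * b), (c * a', c * b'))"
    unfolding c(2) L_eq by (simp add: mat_mult_def vec_mat_def mult.commute)
  finally show ?thesis using c(1) L(1) unfolding scalar_D8_def L_eq by blast
qed

lemma det2_neq_0_imp_neq: "det2 s t \<noteq> 0 \<Longrightarrow> s \<noteq> t"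
  by auto

text \<open>
  In the coordinate \<open>snd s / fst s\<close> of the projective line this is the orbit \<open>{t, -t, 1/t, -1/t}\<close>
  of the Klein four-group that \<open>D8\<close> induces there.
\<close>

definition klein_orbit :: "'f::field \<Rightarrow> ('f \<times> 'f) set"
  where "klein_orbit t = {(1, t), (1, -t), (t, 1), (t, -1)}"

lemma D8_invariant_klein_orbit: "D8_invariant (klein_orbit t)"
  unfolding D8_invariant_def D8_mats_def klein_orbit_def
  by (intro ballI; elim insertE emptyE; simp add: vec_mat_def)

lemma det2_klein_orbit:
  fixes t :: "'f::field"
  shows "det2 (1, t) (1, -t) = - (2 * t)" "det2 (1, t) (t, 1) = 1 - t\<^sup>2"
    "det2 (1, t) (t, -1) = - (1 + t\<^sup>2)" "det2 (1, -t) (t, 1) = 1 + t\<^sup>2"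
    "det2 (1, -t) (t, -1) = - (1 - t\<^sup>2)" "det2 (t, 1) (t, -1) = - (2 * t)"
    "det2 (1, -t) (1, t) = 2 * t" "det2 (t, 1) (1, t) = - (1 - t\<^sup>2)" "det2 (t, -1) (1, t) = 1 + t\<^sup>2"
    "det2 (t, 1) (1, -t) = - (1 + t\<^sup>2)" "det2 (t, -1) (1, -t) = 1 - t\<^sup>2" "det2 (t, -1) (t, 1) = 2 * t"
  by (simp_all add: det2_def power2_eq_square algebra_simps)

text \<open>
  The cross-ratio of the four directions \<open>t, -t, 1/t, -1/t\<close>, in this order, is \<open>b / c\<close>. Up to the
  Klein four-group, a permutation of four points changes it to one of
  \<open>c / b, a / c, c / a, - a / b, - b / a\<close>. With \<open>c = a + b\<close>, equality with the old value would
  mean \<open>b + c = 0\<close>, \<open>a = b\<close>, \<open>a + c = 0\<close> (harmonic cross-ratios) or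
  \<open>a\<^sup>2 + a b + b\<^sup>2 = 0\<close> (equianharmonic ones). Otherwise only the four-group remains.
\<close>

lemma klein_orbit_rigid:
  fixes t :: "'f::field"
  defines "a \<equiv> 4 * t\<^sup>2" and "b \<equiv> (1 - t\<^sup>2)\<^sup>2" and "c \<equiv> (1 + t\<^sup>2)\<^sup>2"
  assumes nz: "a \<noteq> 0" "b \<noteq> 0" "c \<noteq> 0"
    and nonharmonic: "a \<noteq> b" "a + c \<noteq> 0" "b + c \<noteq> 0"
    and nonequianharmonic: "a\<^sup>2 + a * b + b\<^sup>2 \<noteq> 0"
    and M: "det_mat M \<noteq> 0" and \<sigma>: "\<sigma> ` klein_orbit t \<subseteq> klein_orbit t" "inj_on \<sigma> (klein_orbit t)"
    and dir: "\<And>s. s \<in> klein_orbit t \<Longrightarrow> det2 (vec_mat (\<sigma> s) M) s = 0"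
  shows "scalar_D8 M"
proof -
  let ?u1 = "(1 :: 'f, t)" and ?u2 = "(1 :: 'f, -t)" and ?u3 = "(t, 1 :: 'f)" and ?u4 = "(t, -1 :: 'f)"
  define x y z where xyz: "x = 2 * t" "y = 1 - t\<^sup>2" "z = 1 + t\<^sup>2"
  have sq: "a = x\<^sup>2" "b = y\<^sup>2" "c = z\<^sup>2"
    by (simp_all add: a_def b_def c_def xyz power2_eq_square)
  have abc: "c = a + b" by (simp add: a_def b_def c_def power2_eq_square algebra_simps)
  have d: "det2 ?u1 ?u2 = - x" "det2 ?u1 ?u3 = y" "det2 ?u1 ?u4 = - z" "det2 ?u2 ?u3 = z"
    "det2 ?u2 ?u4 = - y" "det2 ?u3 ?u4 = - x" "det2 ?u2 ?u1 = x" "det2 ?u3 ?u1 = - y" "det2 ?u4 ?u1 = z"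
    "det2 ?u3 ?u2 = - z" "det2 ?u4 ?u2 = y" "det2 ?u4 ?u3 = x"
    unfolding xyz by (rule det2_klein_orbit)+
  have xyz0: "x \<noteq> 0" "y \<noteq> 0" "z \<noteq> 0" using nz unfolding sq by auto
  have u: "?u1 \<in> klein_orbit t" "?u2 \<in> klein_orbit t" "?u3 \<in> klein_orbit t" "?u4 \<in> klein_orbit t"
    by (auto simp: klein_orbit_def)
  have distinct: "?u1 \<noteq> ?u2" "?u1 \<noteq> ?u3" "?u1 \<noteq> ?u4" "?u2 \<noteq> ?u3" "?u2 \<noteq> ?u4" "?u3 \<noteq> ?u4"
    by (rule det2_neq_0_imp_neq; simp only: d neg_equal_0_iff_equal xyz0 simp_thms)+
  define v1 v2 v3 v4 where v_def: "v1 = \<sigma> ?u1" "v2 = \<sigma> ?u2" "v3 = \<sigma> ?u3" "v4 = \<sigma> ?u4"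
  have v: "v1 \<in> klein_orbit t" "v2 \<in> klein_orbit t" "v3 \<in> klein_orbit t" "v4 \<in> klein_orbit t"
    using \<sigma>(1) u by (auto simp: v_def)
  have v_distinct: "v1 \<noteq> v2" "v1 \<noteq> v3" "v1 \<noteq> v4" "v2 \<noteq> v3" "v2 \<noteq> v4" "v3 \<noteq> v4"
    unfolding v_def using inj_onD[OF \<sigma>(2)] u distinct by metis+
  have v_dir: "det2 (vec_mat v1 M) ?u1 = 0" "det2 (vec_mat v2 M) ?u2 = 0"
    "det2 (vec_mat v3 M) ?u3 = 0" "det2 (vec_mat v4 M) ?u4 = 0"
    unfolding v_def using dir u by blast+
  have "det2 v1 v3 * det2 v2 v4 * (det2 ?u2 ?u3 * det2 ?u1 ?u4) = det2 v2 v3 * det2 v1 v4 * (det2 ?u1 ?u3 * det2 ?u2 ?u4)"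
    by (rule cross_ratio_preserved[OF M _ _ _ _ v_dir]) (simp_all add: zero_prod_def)
  then have cr: "det2 v1 v3 * det2 v2 v4 * c = det2 v2 v3 * det2 v1 v4 * b"
    unfolding d sq by (simp add: power2_eq_square)
  have no: "c * c \<noteq> b * b" "a * c \<noteq> c * b" "c * c \<noteq> a * b" "a * c \<noteq> - (b * b)" "b * c \<noteq> - (a * b)"
  proof -
    have "c * c - b * b = a * (b + c)" unfolding abc by (simp add: algebra_simps)
    then show "c * c \<noteq> b * b" using nz(1) nonharmonic(3) by (metis diff_self mult_eq_0_iff)
    have "c * c - a * b = a\<^sup>2 + a * b + b\<^sup>2" unfolding abc by (simp add: power2_eq_square algebra_simps)
    then show "c * c \<noteq> a * b" using nonequianharmonic by (metis diff_self)
    have "a * c - - (b * b) = a\<^sup>2 + a * b + b\<^sup>2" unfolding abc by (simp add: power2_eq_square algebra_simps)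
    then show "a * c \<noteq> - (b * b)" using nonequianharmonic by (metis diff_self)
    show "a * c \<noteq> c * b" using nz(3) nonharmonic(1) by (metis mult.commute mult_left_cancel)
    have "b * c - - (a * b) = b * (a + c)" by (simp add: algebra_simps)
    then show "b * c \<noteq> - (a * b)" using nz(2) nonharmonic(2) by (metis diff_self mult_eq_0_iff)
  qed
  have "\<exists>N\<in>D8_mats. (v1 = vec_mat ?u1 N \<or> v1 = - vec_mat ?u1 N) \<and> (v2 = vec_mat ?u2 N \<or> v2 = - vec_mat ?u2 N) \<and>
     (v3 = vec_mat ?u3 N \<or> v3 = - vec_mat ?u3 N)"
  proof (rule ccontr)
    assume "\<not> ?thesis"
    then have notK: "\<not> (v1 = ?u1 \<and> v2 = ?u2 \<and> v3 = ?u3)" "\<not> (v1 = ?u2 \<and> v2 = ?u1 \<and> v3 = ?u4)"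
      "\<not> (v1 = ?u3 \<and> v2 = ?u4 \<and> v3 = ?u1)" "\<not> (v1 = ?u4 \<and> v2 = ?u3 \<and> v3 = ?u2)"
      by (auto simp: D8_mats_def vec_mat_def)
    have prods: "x * x = a" "y * y = b" "z * z = c" unfolding sq by (simp_all add: power2_eq_square)
    show False
      using v(1)[unfolded klein_orbit_def] v(2)[unfolded klein_orbit_def]
        v(3)[unfolded klein_orbit_def] v(4)[unfolded klein_orbit_def]
      \<comment> \<open>The 24 injective choices of the images; the four that come from \<open>D8\<close> are excluded by \<open>notK\<close>.\<close>
      apply (elim insertE emptyE)
      using notK v_distinct apply (simp_all only: simp_thms)
      using cr apply (simp_all only: d minus_mult_left[symmetric] minus_mult_right[symmetric] minus_minus prods)
      \<comment> \<open>In each of the other 20 cases the cross-ratio equation is one of \<open>no\<close>.\<close>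
      using no by (metis minus_minus)+
  qed
  then obtain N where N: "N \<in> D8_mats" and v_eq: "v1 = vec_mat ?u1 N \<or> v1 = - vec_mat ?u1 N"
    "v2 = vec_mat ?u2 N \<or> v2 = - vec_mat ?u2 N" "v3 = vec_mat ?u3 N \<or> v3 = - vec_mat ?u3 N" by blast
  show ?thesis
    by (rule agrees_with_D8_imp_scalar_D8[OF M N _ _ _ v_eq(1,2,3) v_dir(1,2,3)]) (use d xyz0 in auto)
qed

section \<open>The field with 17 elements\<close>

text \<open>
  Finite verifications are carried out on pairs of integers and transferred to the field by \<open>of_int_pair\<close>.
\<close>

definition of_int_pair :: "int \<times> int \<Rightarrow> 'f::field \<times> 'f"
  where "of_int_pair s = (of_int (fst s), of_int (snd s))"

definition int_det2 :: "int \<times> int \<Rightarrow> int \<times> int \<Rightarrow> int"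
  where "int_det2 s t = fst s * snd t - snd s * fst t"

lemma det2_of_int_pair: "det2 (of_int_pair s) (of_int_pair t) = of_int (int_det2 s t)"
  by (simp add: det2_def of_int_pair_def int_det2_def)

text \<open>
  In the field with 17 elements all orbits \<open>{t, -t, 1/t, -1/t}\<close> of size four are harmonic, so none of them is
  rigid. The orbit of \<open>3\<close> together with the axis directions is.
\<close>

definition dirs17 :: "(int \<times> int) list"
  where "dirs17 = [(1, 0), (0, 1), (1, 3), (1, -3), (3, 1), (3, -1)]"

text \<open>
  The equation of \<open>cross_ratio_preserved\<close> modulo 17 for the directions \<open>(1, 0)\<close>, \<open>(0, 1)\<close>, \<open>(1, 3)\<close>, \<open>s\<close>
  with images \<open>a\<close>, \<open>b\<close>, \<open>c\<close>, \<open>y\<close>.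
\<close>

definition cross17 :: "int \<times> int \<Rightarrow> int \<times> int \<Rightarrow> int \<times> int \<Rightarrow> int \<times> int \<Rightarrow> int \<times> int \<Rightarrow> bool"
  where "cross17 a b c s y \<longleftrightarrow>
    (int_det2 a c * int_det2 b y * (int_det2 (0, 1) (1, 3) * int_det2 (1, 0) s) -
     int_det2 b c * int_det2 a y * (int_det2 (1, 0) (1, 3) * int_det2 (0, 1) s)) mod 17 = 0"

text \<open>
  A projectivity is determined by the images \<open>a\<close>, \<open>b\<close>, \<open>c\<close> of three points, and the images of the
  other three directions must again be in the set. Of the 120 choices for \<open>(a, b, c)\<close> exactly the four
  coming from \<open>D8\<close> pass this test.
\<close>

lemma dirs17_cross_ratios:
  "\<forall>a\<in>set dirs17. \<forall>b\<in>set dirs17. \<forall>c\<in>set dirs17. a \<noteq> b \<longrightarrow> a \<noteq> c \<longrightarrow> b \<noteq> c \<longrightarrow>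
     list_ex (cross17 a b c (1, -3)) dirs17 \<longrightarrow> list_ex (cross17 a b c (3, 1)) dirs17 \<longrightarrow>
     list_ex (cross17 a b c (3, -1)) dirs17 \<longrightarrow>
     (a, b, c) \<in> set [((1, 0), (0, 1), (1, 3)), ((1, 0), (0, 1), (1, -3)),
       ((0, 1), (1, 0), (3, 1)), ((0, 1), (1, 0), (3, -1))]"
  by code_simp

lemma dirs17_distinct: "\<forall>s\<in>set dirs17. \<forall>t\<in>set dirs17. s \<noteq> t \<longrightarrow> int_det2 s t mod 17 \<noteq> 0"
  by code_simp

lemma of_int_pair_dirs17:
  "of_int_pair ` set dirs17 = {(1, 0), (0, 1), (1, 3), (1, -3), (3, 1), (3, -1 :: 'f::field)}"
  by (simp add: dirs17_def of_int_pair_def)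

lemma D8_invariant_dirs17: "D8_invariant (of_int_pair ` set dirs17)"
  unfolding D8_invariant_def D8_mats_def of_int_pair_dirs17
  by (intro ballI; elim insertE emptyE; simp add: vec_mat_def)

lemma of_int_pair_dirs17_indep:
  assumes "prime CARD('f::{field,finite})" "CARD('f) = 17" "s \<in> set dirs17" "t \<in> set dirs17" "s \<noteq> t"
  shows "det2 (of_int_pair s) (of_int_pair t) \<noteq> (0 :: 'f)"
  using dirs17_distinct assms(3-5) of_int_eq_0_prime_field[OF assms(1), of "int_det2 s t"] assms(2)
  by (auto simp: det2_of_int_pair dvd_eq_mod_eq_0)

lemma dirs17_rigid:
  fixes M :: "'f::{field,finite} mat2"
  assumes p: "prime CARD('f)" "CARD('f) = 17"
    and M: "det_mat M \<noteq> 0"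
    and \<sigma>: "\<sigma> ` of_int_pair ` set dirs17 \<subseteq> of_int_pair ` set dirs17" "inj_on \<sigma> (of_int_pair ` set dirs17)"
    and dir: "\<And>s. s \<in> of_int_pair ` set dirs17 \<Longrightarrow> det2 (vec_mat (\<sigma> s) M) s = 0"
  shows "scalar_D8 M"
proof -
  have zero: "(of_int k :: 'f) = 0 \<longleftrightarrow> k mod 17 = 0" for k
    using of_int_eq_0_prime_field[OF p(1), of k] p(2) by (simp add: dvd_eq_mod_eq_0)
  have "\<exists>s'\<in>set dirs17. \<sigma> (of_int_pair s) = of_int_pair s'" if "s \<in> set dirs17" for s
    using \<sigma>(1) that by blast
  then obtain \<rho> where \<rho>: "\<And>s. s \<in> set dirs17 \<Longrightarrow> \<rho> s \<in> set dirs17"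
    "\<And>s. s \<in> set dirs17 \<Longrightarrow> \<sigma> (of_int_pair s) = of_int_pair (\<rho> s)" by metis
  have \<rho>_dir: "det2 (vec_mat (of_int_pair (\<rho> s)) M) (of_int_pair s) = 0" if "s \<in> set dirs17" for s
    using dir[of "of_int_pair s"] \<rho>(2)[OF that] that by simp
  have \<rho>_inj: "\<rho> s \<noteq> \<rho> t" if "s \<in> set dirs17" "t \<in> set dirs17" "s \<noteq> t" for s t
  proof
    assume "\<rho> s = \<rho> t"
    then have "\<sigma> (of_int_pair s) = \<sigma> (of_int_pair t)" using \<rho>(2) that by simp
    then have "of_int_pair s = (of_int_pair t :: 'f \<times> 'f)" using inj_onD[OF \<sigma>(2)] that by blast
    then show False using of_int_pair_dirs17_indep[OF p that] by simp
  qed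
  have nz: "of_int_pair s \<noteq> (0 :: 'f \<times> 'f)" if s: "s \<in> set dirs17" for s
  proof -
    let ?t = "if s = (1, 0) then (0, 1) else (1, 0)"
    have "?t \<in> set dirs17" "s \<noteq> ?t" by (simp_all add: dirs17_def)
    then show ?thesis using of_int_pair_dirs17_indep[OF p s, of ?t] det2_neq_0D by blast
  qed
  have mem: "(1, 0) \<in> set dirs17" "(0, 1) \<in> set dirs17" "(1, 3) \<in> set dirs17"
    "(1, -3) \<in> set dirs17" "(3, 1) \<in> set dirs17" "(3, -1) \<in> set dirs17"
    by (simp_all add: dirs17_def)
  define a b c where abc: "a = \<rho> (1, 0)" "b = \<rho> (0, 1)" "c = \<rho> (1, 3)"
  have "list_ex (cross17 a b c s) dirs17" if s: "s \<in> set dirs17" for s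
  proof -
    have "det2 (of_int_pair a) (of_int_pair c) * det2 (of_int_pair b) (of_int_pair (\<rho> s)) * (det2 (of_int_pair (0, 1)) (of_int_pair (1, 3)) * det2 (of_int_pair (1, 0)) (of_int_pair s)) =
      det2 (of_int_pair b) (of_int_pair c) * det2 (of_int_pair a) (of_int_pair (\<rho> s)) * (det2 (of_int_pair (1, 0)) (of_int_pair (1, 3)) * det2 (of_int_pair (0, 1)) (of_int_pair s) :: 'f)"
      unfolding abc using M nz \<rho>_dir mem s by (intro cross_ratio_preserved[OF M]) auto
    then have "cross17 a b c s (\<rho> s)"
      unfolding cross17_def zero[symmetric] det2_of_int_pair by simp
    then show ?thesis using \<rho>(1)[OF s] by (auto simp: list_ex_iff)
  qed
  note ex = this
  have "a \<noteq> b" "a \<noteq> c" "b \<noteq> c" unfolding abc by (rule \<rho>_inj; simp add: mem)+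
  then have "(a, b, c) \<in> set [((1, 0), (0, 1), (1, 3)), ((1, 0), (0, 1), (1, -3)),
       ((0, 1), (1, 0), (3, 1)), ((0, 1), (1, 0), (3, -1))]"
    using \<rho>(1)[OF mem(1)] \<rho>(1)[OF mem(2)] \<rho>(1)[OF mem(3)] ex[OF mem(4)] ex[OF mem(5)] ex[OF mem(6)]
    unfolding abc[symmetric] by (intro dirs17_cross_ratios[rule_format])
  then consider "a = (1, 0)" "b = (0, 1)" "c = (1, 3)" | "a = (1, 0)" "b = (0, 1)" "c = (1, -3)"
    | "a = (0, 1)" "b = (1, 0)" "c = (3, 1)" | "a = (0, 1)" "b = (1, 0)" "c = (3, -1)"
    by auto
  then have "\<exists>N\<in>D8_mats. (of_int_pair a = vec_mat (of_int_pair (1, 0)) N \<or> of_int_pair a = - vec_mat (of_int_pair (1, 0)) N) \<and>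
     (of_int_pair b = vec_mat (of_int_pair (0, 1)) N \<or> of_int_pair b = - vec_mat (of_int_pair (0, 1)) N) \<and>
     (of_int_pair c = vec_mat (of_int_pair (1, 3)) N \<or> of_int_pair c = - (vec_mat (of_int_pair (1, 3)) N :: 'f \<times> 'f))"
  proof cases
    case 1
    then show ?thesis
      by (intro bexI[of _ "((1, 0), (0, 1))"]) (simp_all add: D8_mats_def vec_mat_def of_int_pair_def)
  next
    case 2
    then show ?thesis
      by (intro bexI[of _ "((1, 0), (0, -1))"]) (simp_all add: D8_mats_def vec_mat_def of_int_pair_def)
  next
    case 3
    then show ?thesis
      by (intro bexI[of _ "((0, 1), (1, 0))"]) (simp_all add: D8_mats_def vec_mat_def of_int_pair_def)
  next
    case 4
    then show ?thesis
      by (intro bexI[of _ "((0, -1), (1, 0))"]) (simp_all add: D8_mats_def vec_mat_def of_int_pair_def)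
  qed
  then obtain N where N: "N \<in> D8_mats" and img: "of_int_pair a = vec_mat (of_int_pair (1, 0)) N \<or> of_int_pair a = - vec_mat (of_int_pair (1, 0)) N"
     "of_int_pair b = vec_mat (of_int_pair (0, 1)) N \<or> of_int_pair b = - vec_mat (of_int_pair (0, 1)) N"
     "of_int_pair c = vec_mat (of_int_pair (1, 3)) N \<or> of_int_pair c = - (vec_mat (of_int_pair (1, 3)) N :: 'f \<times> 'f)"
    by blast
  show ?thesis
  proof (rule agrees_with_D8_imp_scalar_D8[OF M N _ _ _ img])
    show "det2 (of_int_pair (1, 0)) (of_int_pair (0, 1)) \<noteq> (0 :: 'f)" "det2 (of_int_pair (1, 0)) (of_int_pair (1, 3)) \<noteq> (0 :: 'f)"
      "det2 (of_int_pair (1, 3)) (of_int_pair (0, 1)) \<noteq> (0 :: 'f)"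
      by (intro of_int_pair_dirs17_indep[OF p] mem; simp)+
    show "det2 (vec_mat (of_int_pair a) M) (of_int_pair (1, 0)) = 0" "det2 (vec_mat (of_int_pair b) M) (of_int_pair (0, 1)) = 0"
      "det2 (vec_mat (of_int_pair c) M) (of_int_pair (1, 3)) = 0"
      unfolding abc by (intro \<rho>_dir mem)+
  qed
qed

section \<open>Digraphs with the prescribed automorphism group\<close>

lemma Aut_klein_orbit:
  fixes t :: "'f::{field,finite}"
  defines "a \<equiv> 4 * t\<^sup>2" and "b \<equiv> (1 - t\<^sup>2)\<^sup>2" and "c \<equiv> (1 + t\<^sup>2)\<^sup>2"
  assumes prime: "prime CARD('f)" and m: "CARD('m::finite) \<ge> 2" and card: "4 \<le> CARD('f)"
    and nz: "a \<noteq> 0" "b \<noteq> 0" "c \<noteq> 0"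
    and nonharmonic: "a - b \<noteq> 0" "a + c \<noteq> 0" "b + c \<noteq> 0"
    and nonequianharmonic: "a\<^sup>2 + a * b + b\<^sup>2 \<noteq> 0"
  shows "digraph_Aut (net_arcs (klein_orbit t) form) = (G_group :: ('f ^ (2 \<times> 'm) \<Rightarrow> 'f ^ (2 \<times> 'm)) set)"
proof (rule Aut_net_eq_G_group[OF prime m _ _ D8_invariant_klein_orbit])
  have "t \<noteq> 0" "2 \<noteq> (0 :: 'f)" "1 - t\<^sup>2 \<noteq> 0" "1 + t\<^sup>2 \<noteq> 0"
  proof -
    have "a = 2 * (2 * t\<^sup>2)" by (simp add: a_def)
    then show "2 \<noteq> (0 :: 'f)" using nz(1) by (metis mult_zero_left)
    show "t \<noteq> 0" using nz(1) by (auto simp: a_def)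
  qed (use nz in \<open>auto simp: b_def c_def\<close>)
  then have nz': "2 * t \<noteq> 0" "1 - t\<^sup>2 \<noteq> 0" "1 + t\<^sup>2 \<noteq> 0" by simp_all
  note nonzero = det2_klein_orbit neg_equal_0_iff_equal nz' simp_thms
  show indep: "det2 s r \<noteq> 0" if "s \<in> klein_orbit t" "r \<in> klein_orbit t" "s \<noteq> r" for s r
    using that unfolding klein_orbit_def by (elim insertE emptyE; simp only: nonzero)
  show "finite (klein_orbit t)" by (simp add: klein_orbit_def)
  have "card (klein_orbit t) \<le> 4" by (simp add: klein_orbit_def card_insert_if)
  then show "card (klein_orbit t) \<le> CARD('f)" using card by simp
  show "(1, t) \<in> klein_orbit t" "(1, -t) \<in> klein_orbit t" "(t, 1) \<in> klein_orbit t"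
    by (simp_all add: klein_orbit_def)
  show "(1 :: 'f, t) \<noteq> (1 :: 'f, -t)" "(1, t) \<noteq> (t, 1)" "(1, -t) \<noteq> (t, 1)"
    by (rule det2_neq_0_imp_neq; simp only: nonzero)+
  have "a \<noteq> b" using nonharmonic(1) by auto
  then show "scalar_D8 M" if "det_mat M \<noteq> 0" "\<sigma> ` klein_orbit t \<subseteq> klein_orbit t" "inj_on \<sigma> (klein_orbit t)"
    "\<And>s. s \<in> klein_orbit t \<Longrightarrow> det2 (vec_mat (\<sigma> s) M) s = 0" for M \<sigma>
    using klein_orbit_rigid[of t, folded a_def b_def c_def, OF nz _ nonharmonic(2,3) nonequianharmonic that]
    by blast
qed

lemma Aut_dirs17:
  assumes prime: "prime CARD('f::{field,finite})" and m: "CARD('m::finite) \<ge> 2" and p: "CARD('f) = 17"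
  shows "digraph_Aut (net_arcs (of_int_pair ` set dirs17) form) = (G_group :: ('f ^ (2 \<times> 'm) \<Rightarrow> 'f ^ (2 \<times> 'm)) set)"
proof (rule Aut_net_eq_G_group[OF prime m _ _ D8_invariant_dirs17])
  show "finite (of_int_pair ` set dirs17)" by simp
  have "card (of_int_pair ` set dirs17 :: ('f \<times> 'f) set) \<le> card (set dirs17)" by (intro card_image_le) simp
  also have "\<dots> \<le> length dirs17" by (rule card_length)
  finally show "card (of_int_pair ` set dirs17 :: ('f \<times> 'f) set) \<le> CARD('f)" by (simp add: p dirs17_def)
  show "det2 s r \<noteq> 0" if "s \<in> of_int_pair ` set dirs17" "r \<in> of_int_pair ` set dirs17" "s \<noteq> r" for s r :: "'f \<times> 'f"
    using that of_int_pair_dirs17_indep[OF prime p] by blast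
  show "(1, 0) \<in> of_int_pair ` set dirs17" "(0, 1) \<in> of_int_pair ` set dirs17" "(1, 3) \<in> of_int_pair ` set dirs17"
    unfolding of_int_pair_dirs17 by simp_all
  have "(of_int 3 :: 'f) \<noteq> 0" unfolding of_int_eq_0_prime_field[OF prime] p by simp
  then show "(1, 0) \<noteq> (1, 3 :: 'f)" by simp
  show "scalar_D8 M" if "det_mat M \<noteq> 0" "\<sigma> ` of_int_pair ` set dirs17 \<subseteq> of_int_pair ` set dirs17" "inj_on \<sigma> (of_int_pair ` set dirs17)"
    "\<And>s. s \<in> of_int_pair ` set dirs17 \<Longrightarrow> det2 (vec_mat (\<sigma> s) M) s = 0" for \<sigma> and M :: "'f mat2"
    by (rule dirs17_rigid[OF prime p that])
qed simp_all

text \<open>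
  For \<open>t = 2\<close> the numbers \<open>a, b, c\<close> of \<open>klein_orbit_rigid\<close> are 16, 9 and 25, so the
  conditions exclude the odd prime divisors of 16, 9, 25, 16 - 9 = 7, 16 + 25 = 41, 9 + 25 = 2 * 17 and
  256 + 144 + 81 = 13 * 37. The primes 37 and 41 are served by \<open>t = 4\<close>, and 17 by \<open>dirs17\<close>; only
  3, 5, 7 and 13 are left.
\<close>

theorem exists_digraph:
  assumes prime: "prime CARD('f::{field,finite})" and odd: "odd CARD('f)" and m: "CARD('m::finite) \<ge> 2"
    and p: "CARD('f) \<notin> {3, 5, 7, 13}"
  shows "\<exists>E. digraph E \<and> digraph_Aut E = (G_group :: ('f ^ (2 \<times> 'm) \<Rightarrow> 'f ^ (2 \<times> 'm)) set)"
proof -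
  have "\<exists>R. digraph_Aut (net_arcs R form) = (G_group :: ('f ^ (2 \<times> 'm) \<Rightarrow> 'f ^ (2 \<times> 'm)) set)"
  proof (cases "CARD('f) = 17")
    case True
    then show ?thesis using Aut_dirs17[OF prime m] by blast
  next
    case False
    have ge: "4 \<le> CARD('f)"
    proof -
      have "CARD('f) \<noteq> 2" using odd by auto
      then show ?thesis using prime_ge_2_nat[OF prime] p by auto
    qed
    have zero: "(numeral k :: 'f) = 0 \<longleftrightarrow> CARD('f) dvd numeral k" for k
      using of_int_eq_0_prime_field[OF prime, of "numeral k"] by (metis int_dvd_int_iff of_int_numeral of_nat_numeral)
    show ?thesis
    proof (cases "CARD('f) = 37 \<or> CARD('f) = 41")
      case True
      have "digraph_Aut (net_arcs (klein_orbit (4 :: 'f)) form) = (G_group :: ('f ^ (2 \<times> 'm) \<Rightarrow> 'f ^ (2 \<times> 'm)) set)"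
        by (rule Aut_klein_orbit[OF prime m ge]) (use True in \<open>auto simp: zero\<close>)
      then show ?thesis by blast
    next
      case False
      have no_prime: "\<not> CARD('f) dvd q" if "prime q" "CARD('f) \<noteq> q" for q :: nat
        using primes_dvd_imp_eq[OF prime that(1)] that(2) by blast
      have nd: "\<not> CARD('f) dvd 2" "\<not> CARD('f) dvd 3" "\<not> CARD('f) dvd 5" "\<not> CARD('f) dvd 7"
        "\<not> CARD('f) dvd 13" "\<not> CARD('f) dvd 17" "\<not> CARD('f) dvd 37" "\<not> CARD('f) dvd 41"
        by (rule no_prime, simp, use ge p False \<open>CARD('f) \<noteq> 17\<close> in force)+
      have "\<not> CARD('f) dvd 2 ^ 4" "\<not> CARD('f) dvd 3 ^ 2" "\<not> CARD('f) dvd 5 ^ 2"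
        using nd prime_dvd_power[OF prime] by blast+
      moreover have "\<not> CARD('f) dvd 2 * 17" "\<not> CARD('f) dvd 13 * 37"
        unfolding prime_dvd_mult_iff[OF prime] using nd by blast+
      ultimately have nd': "\<not> CARD('f) dvd 16" "\<not> CARD('f) dvd 9" "\<not> CARD('f) dvd 25"
        "\<not> CARD('f) dvd 34" "\<not> CARD('f) dvd 481" by simp_all
      have "digraph_Aut (net_arcs (klein_orbit (2 :: 'f)) form) = (G_group :: ('f ^ (2 \<times> 'm) \<Rightarrow> 'f ^ (2 \<times> 'm)) set)"
        by (rule Aut_klein_orbit[OF prime m ge]) (simp_all add: zero nd nd')
      then show ?thesis by blast
    qed
  qed
  then show ?thesis using digraph_net_arcs by blast
qed

section \<open>Digraphs invariant under the group\<close>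

lemma GL_extend:
  fixes f :: "'f::field ^ 'm::finite \<Rightarrow> 'f ^ 'm"
  assumes "vec.independent S" "vec.independent (f ` S)" "inj_on f S"
  shows "\<exists>B\<in>GL. \<forall>x\<in>S. B x = f x"
proof -
  obtain g where g: "Vector_Spaces.linear (*s) (*s) g" "inj g" "\<forall>x\<in>S. g x = f x"
    using vec.linear_independent_extend_inj[OF assms] by blast
  have "bij g" using vec.linear_inj_imp_surj[OF g(1,2)] g(2) by (simp add: bij_def)
  then have "g \<in> GL" using g(1) by (simp add: GL_def)
  then show ?thesis using g(3) by blast
qed

text \<open>
  Rank two: the two rows are linearly independent.
\<close>

definition generic :: "'f::field ^ (2 \<times> 'm::finite) \<Rightarrow> bool"
  where "generic d \<longleftrightarrow> (\<forall>s. s \<noteq> 0 \<longrightarrow> form s d \<noteq> 0)"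

lemma generic_independent:
  fixes d :: "'f::field ^ (2 \<times> 'm::finite)"
  assumes "generic d"
  shows "tensor_row 1 d \<noteq> tensor_row 2 d" "vec.independent {tensor_row 1 d, tensor_row 2 d}"
proof -
  have nz: "form (a, b) d \<noteq> 0" if "(a, b) \<noteq> 0" for a b using assms that by (simp add: generic_def)
  show ne: "tensor_row 1 d \<noteq> tensor_row 2 d"
  proof
    assume "tensor_row 1 d = tensor_row 2 d"
    then have "form (1, -1) d = 0" by (simp add: form_def vec_eq_iff)
    then show False using nz[of 1 "-1"] by (simp add: zero_prod_def)
  qed
  have "tensor_row 2 d \<noteq> 0" using nz[of 0 1] by (auto simp: form_def zero_prod_def)
  moreover have "tensor_row 1 d \<notin> vec.span {tensor_row 2 d}"
  proof
    assume "tensor_row 1 d \<in> vec.span {tensor_row 2 d}"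
    then obtain k where "tensor_row 1 d = k *s tensor_row 2 d" by (auto simp: vec.span_singleton)
    then have "form (1, -k) d = 0" by (simp add: form_def vec_eq_iff)
    then show False using nz[of 1 "-k"] by (simp add: zero_prod_def)
  qed
  ultimately show "vec.independent {tensor_row 1 d, tensor_row 2 d}"
    using ne by (simp add: vec.independent_insert)
qed

text \<open>
  Two independent vectors of \<open>W\<close> can be mapped to any two independent vectors by a linear bijection, so all differences
  of rank two lie in one orbit.
\<close>

lemma generic_transitive:
  fixes d d' :: "'f::field ^ (2 \<times> 'm::finite)"
  assumes "generic d" "generic d'"
  shows "\<exists>B\<in>GL. kron ((1, 0), (0, 1)) B d = d'"
proof -
  let ?f = "\<lambda>u. if u = tensor_row 1 d then tensor_row 1 d' else tensor_row 2 d'"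
  have "\<exists>B\<in>GL. \<forall>x\<in>{tensor_row 1 d, tensor_row 2 d}. B x = ?f x"
    using generic_independent[OF assms(1)] generic_independent[OF assms(2)]
    by (intro GL_extend) (auto simp: insert_commute)
  then obtain B where "B \<in> GL" "B (tensor_row 1 d) = tensor_row 1 d'" "B (tensor_row 2 d) = tensor_row 2 d'"
    using generic_independent(1)[OF assms(1)] by auto
  then show ?thesis by (intro bexI[of _ B] stack_eqI) (simp_all add: kron_def form_def)
qed

lemma GL_transitive:
  fixes u v :: "'f::field ^ 'm::finite"
  assumes "u \<noteq> 0" "v \<noteq> 0"
  shows "\<exists>B\<in>GL. B u = v"
  using GL_extend[of "{u}" "\<lambda>_. v"] assms by (auto simp: vec.independent_insert)

text \<open>
  The tensor \<open>(snd s, - fst s) \<otimes> w\<close>, whose first factor annihilates \<open>s\<close>.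
\<close>

definition rank_one :: "'f::field \<times> 'f \<Rightarrow> 'f ^ 'm \<Rightarrow> 'f ^ (2 \<times> 'm::finite)"
  where "rank_one s w = stack (snd s *s w) (- fst s *s w)"

lemma form_rank_one: "form r (rank_one s w) = det2 r s *s w"
  by (simp add: rank_one_def form_stack det2_def vec_eq_iff algebra_simps)

lemma form_zero_iff_rank_one:
  fixes d :: "'f::field ^ (2 \<times> 'm::finite)"
  assumes "s \<noteq> 0"
  shows "form s d = 0 \<longleftrightarrow> (\<exists>w. d = rank_one s w)"
proof
  assume f: "form s d = 0"
  have "\<exists>t. det2 s t \<noteq> 0"
  proof (cases "fst s = 0")
    case True
    then show ?thesis using assms by (intro exI[of _ "(1, 0)"]) (auto simp: det2_def prod_eq_iff)
  next
    case False
    then show ?thesis by (intro exI[of _ "(0, 1)"]) (simp add: det2_def)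
  qed
  then obtain t where t: "det2 s t \<noteq> 0" by blast
  let ?w = "inverse (det2 t s) *s form t d"
  have "det2 t s \<noteq> 0" using t det2_swap by metis
  then have "form t d = form t (rank_one s ?w)" "form s d = form s (rank_one s ?w)"
    by (simp_all add: form_rank_one f)
  then show "\<exists>w. d = rank_one s w" using form_eq_iff[OF t] by blast
qed (auto simp: form_rank_one)

lemma id_D8_mats: "((1, 0), (0, 1)) \<in> D8_mats"
  by (simp add: D8_mats_def)

lemma id_GL: "id \<in> GL"
  by (rule GL_I) auto

lemma kron_identity: "kron ((1, 0), (0, 1)) id x = x"
  by (rule stack_eqI) (simp_all add: kron_def form_def)

lemma rank_one_axis: "s \<noteq> 0 \<Longrightarrow> rank_one s (axis undefined 1 :: 'f::field ^ 'm::finite) \<noteq> 0"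
proof
  assume "s \<noteq> 0" and z: "rank_one s (axis undefined 1 :: 'f ^ 'm) = 0"
  have "snd s *s (axis undefined 1 :: 'f ^ 'm) = 0" "- fst s *s (axis undefined 1 :: 'f ^ 'm) = 0"
    using z unfolding rank_one_def by (metis stack_inject stack_zero)+
  then have "snd s = 0" "fst s = 0" by (auto simp: axis_eq_0_iff)
  then show False using \<open>s \<noteq> 0\<close> by (simp add: prod_eq_iff)
qed

lemma vec_mat_neq_0: "det_mat M \<noteq> 0 \<Longrightarrow> s \<noteq> 0 \<Longrightarrow> vec_mat s M \<noteq> (0 :: 'f::field \<times> 'f)"
proof
  assume M: "det_mat M \<noteq> 0" and s: "s \<noteq> 0" and z: "vec_mat s M = 0"
  have "det2 s t * det_mat M = 0" for t unfolding det2_vec_mat[symmetric] z by (simp add: det2_def)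
  then have "det2 s (1, 0) = 0" "det2 s (0, 1) = 0" using M by auto
  then show False using s by (simp add: det2_def prod_eq_iff)
qed

lemma kron_neq_0:
  assumes "det_mat M \<noteq> 0" "B \<in> GL" "d \<noteq> 0"
  shows "kron M B d \<noteq> 0"
proof -
  have "kron M B 0 = 0" by (simp add: kron_def GL_linear[OF assms(2)])
  then show ?thesis using bij_kron[OF assms(2,1)] assms(3) by (metis bij_is_inj injD)
qed

text \<open>
  An arc set preserved by the group is determined by the differences \<open>d\<close> of its arcs. By the transitivity
  of \<open>GL\<close>, membership of a nonzero \<open>d\<close> depends only on whether \<open>d\<close> is generic and, if it is
  not, on its direction.
\<close>

locale invariant_digraph =
  fixes E :: "(('f::{field,finite} ^ (2 \<times> 'm::finite)) \<times> ('f ^ (2 \<times> 'm))) set"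
  assumes inv: "\<And>g. g \<in> G_group \<Longrightarrow> g \<in> digraph_Aut E"
begin

definition diffs :: "('f ^ (2 \<times> 'm)) set"
  where "diffs = {d. (d, 0) \<in> E}"

definition arc_dir :: "'f \<times> 'f \<Rightarrow> bool"
  where "arc_dir s \<longleftrightarrow> rank_one s (axis undefined 1) \<in> diffs"

lemma arc_iff: "(x, y) \<in> E \<longleftrightarrow> x - y \<in> diffs"
proof -
  have "(\<lambda>x. kron ((1, 0), (0, 1)) id x + - y) \<in> G_group"
    unfolding G_group_eq using id_GL id_D8_mats by blast
  from inv[OF this] have "(x, y) \<in> E \<longleftrightarrow> (x + - y, y + - y) \<in> E"
    unfolding digraph_Aut_def kron_identity by blast
  then show ?thesis by (simp add: diffs_def)
qed

lemma diffs_kron: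
  assumes "N \<in> D8_mats" "B \<in> GL"
  shows "kron N B d \<in> diffs \<longleftrightarrow> d \<in> diffs"
proof -
  have "(\<lambda>x. kron N B x + 0) \<in> G_group" unfolding G_group_eq using assms by blast
  from inv[OF this] have "(d, 0) \<in> E \<longleftrightarrow> (kron N B d + 0, kron N B 0 + 0) \<in> E"
    unfolding digraph_Aut_def by blast
  moreover have "kron N B 0 = 0" by (simp add: kron_def GL_linear[OF assms(2)])
  ultimately show ?thesis by (simp add: diffs_def)
qed

lemma diffs_generic: "generic d \<Longrightarrow> generic d' \<Longrightarrow> d \<in> diffs \<longleftrightarrow> d' \<in> diffs"
  using generic_transitive diffs_kron[OF id_D8_mats] by metis

lemma diffs_rank_one:
  assumes "s \<noteq> 0" "d \<noteq> 0" "form s d = 0"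
  shows "d \<in> diffs \<longleftrightarrow> arc_dir s"
proof -
  obtain w where d: "d = rank_one s w" using assms form_zero_iff_rank_one by blast
  then have "w \<noteq> 0" using assms(2) by (auto simp: rank_one_def)
  then obtain B where B: "B \<in> GL" "B (axis undefined 1) = w"
    using GL_transitive[of "axis undefined 1" w] by (auto simp: axis_eq_0_iff)
  have "kron ((1, 0), (0, 1)) B (rank_one s (axis undefined 1)) = d"
    unfolding d by (rule stack_eqI) (simp_all add: kron_def rank_one_def form_stack GL_linear[OF B(1)] B(2))
  then show ?thesis using diffs_kron[OF id_D8_mats B(1)] unfolding arc_dir_def by metis
qed

lemma arc_dir_scale:
  assumes "c \<noteq> 0" "s \<noteq> 0"
  shows "arc_dir (c * fst s, c * snd s) = arc_dir s"
proof -
  let ?d = "rank_one s (axis undefined 1) :: 'f ^ (2 \<times> 'm)"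
  have "(c * fst s, c * snd s) \<noteq> 0" using assms by (auto simp: prod_eq_iff)
  moreover have "form (c * fst s, c * snd s) ?d = 0" by (simp add: form_rank_one det2_def)
  ultimately show ?thesis
    using diffs_rank_one[of "(c * fst s, c * snd s)" ?d] rank_one_axis[OF assms(2)] unfolding arc_dir_def by blast
qed

lemma arc_dir_D8:
  assumes N: "N \<in> D8_mats" and s: "s \<noteq> 0"
  shows "arc_dir (vec_mat s N) = arc_dir s"
proof -
  have M: "det_mat N \<noteq> 0" using det_D8_mats N by blast
  have nz: "vec_mat s N \<noteq> 0" by (rule vec_mat_neq_0[OF M s])
  let ?d = "rank_one (vec_mat s N) (axis undefined 1) :: 'f ^ (2 \<times> 'm)"
  have "form s (kron N id ?d) = 0" by (simp add: form_kron[OF id_GL] form_rank_one)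
  then have "kron N id ?d \<in> diffs \<longleftrightarrow> arc_dir s"
    using diffs_rank_one[OF s] kron_neq_0[OF M id_GL rank_one_axis[OF nz]] by blast
  then show ?thesis unfolding diffs_kron[OF N id_GL] arc_dir_def .
qed

text \<open>
  The generic differences form one orbit and \<open>M\<close> preserves the rank, so whether \<open>M\<close> gives an
  automorphism is decided by its action on directions.
\<close>

lemma linear_automorphism:
  assumes M: "det_mat M \<noteq> 0" and bits: "\<And>s. s \<noteq> 0 \<Longrightarrow> arc_dir (vec_mat s M) = arc_dir s"
  shows "kron M id \<in> digraph_Aut E"
proof -
  have bij: "bij (kron M id :: 'f ^ (2 \<times> 'm) \<Rightarrow> 'f ^ (2 \<times> 'm))" by (rule bij_kron[OF id_GL M])
  have "kron M id d \<in> diffs \<longleftrightarrow> d \<in> diffs" for d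
  proof (cases "d = 0 \<or> generic d")
    case True
    then show ?thesis
    proof
      assume "d = 0"
      then show ?thesis by (simp add: kron_def)
    next
      assume "generic d"
      moreover from this have "generic (kron M id d)"
        using vec_mat_neq_0[OF M] by (metis generic_def form_kron[OF id_GL] id_apply)
      ultimately show ?thesis using diffs_generic by blast
    qed
  next
    case False
    then obtain r where r: "r \<noteq> 0" "form r d = 0" "d \<noteq> 0" by (auto simp: generic_def)
    obtain s where s: "vec_mat s M = r"
    proof -
      have "det2 (fst M) (snd M) \<noteq> 0" using M by (simp add: det_mat_def)
      then have "vec_mat (det2 r (snd M) / det_mat M, det2 (fst M) r / det_mat M) M = r"
        by (simp add: vec_mat_def prod_eq_iff det_mat_def field_simps) (simp add: det2_def algebra_simps)
      then show ?thesis using that by blast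
    qed
    have s0: "s \<noteq> 0" using s r by (auto simp: vec_mat_def zero_prod_def)
    have "form s (kron M id d) = 0" unfolding form_kron[OF id_GL] s by (simp add: r)
    then have "kron M id d \<in> diffs \<longleftrightarrow> arc_dir s"
      using diffs_rank_one[OF s0] kron_neq_0[OF M id_GL r(3)] by blast
    then show ?thesis using diffs_rank_one[OF r(1,3,2)] bits[OF s0] s by simp
  qed
  moreover have "kron M id x - kron M id y = kron M id (x - y)" for x y :: "'f ^ (2 \<times> 'm)"
    by (simp add: kron_def form_diff stack_diff)
  ultimately show ?thesis using bij by (simp add: digraph_Aut_def arc_iff)
qed

end

text \<open>
  A matrix \<open>M'\<close> from \<open>D8\<close> that yields the same map moves all directions in the same way as \<open>M\<close> does.
\<close>

lemma kron_in_G_group_imp_scalar_D8: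
  fixes M :: "'f::{field,finite} mat2"
  assumes M: "det_mat M \<noteq> 0" and G: "(kron M id :: 'f ^ (2 \<times> 'm::finite) \<Rightarrow> 'f ^ (2 \<times> 'm)) \<in> G_group"
  shows "scalar_D8 M"
proof -
  obtain M' B b where M': "M' \<in> D8_mats" and B: "B \<in> GL"
    and eq: "(kron M id :: 'f ^ (2 \<times> 'm) \<Rightarrow> 'f ^ (2 \<times> 'm)) = (\<lambda>x. kron M' B x + b)"
    using G unfolding G_group_eq by blast
  obtain N where N: "N \<in> D8_mats" "mat_mult N M' = ((1, 0), (0, 1))" using D8_mats_inverse[OF M'] by blast
  have dir: "det2 (vec_mat (vec_mat s N) M) s = 0" for s
  proof (rule class_image_direction[OF id_GL, where b = 0])
    fix x y :: "'f ^ (2 \<times> 'm)" assume "form s x = form s y"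
    then show "form (vec_mat s N) (kron M id x + 0) = form (vec_mat s N) (kron M id y + 0)"
      unfolding eq by (simp add: form_add form_kron[OF B] vec_mat_mult N)
  qed
  show ?thesis
    by (rule agrees_with_D8_imp_scalar_D8[OF M N(1), of "(1, 0)" "(0, 1)" "(1, 1)"
          "vec_mat (1, 0) N" "vec_mat (0, 1) N" "vec_mat (1, 1) N"])
      (simp_all add: dir, simp_all add: det2_def)
qed

lemma scalar_D8_D:
  assumes "scalar_D8 ((a, b), (c, d))"
  shows "b = 0 \<and> c = 0 \<and> a\<^sup>2 = d\<^sup>2 \<or> a = 0 \<and> d = 0 \<and> b\<^sup>2 = c\<^sup>2"
proof -
  obtain k a' b' c' d' where k: "((a', b'), (c', d')) \<in> D8_mats"
    and eq: "((a, b), (c, d)) = ((k * a', k * b'), (k * c', k * d'))"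
    using assms unfolding scalar_D8_def by blast
  have "b' = 0 \<and> c' = 0 \<and> a'\<^sup>2 = 1 \<and> d'\<^sup>2 = 1 \<or> a' = 0 \<and> d' = 0 \<and> b'\<^sup>2 = 1 \<and> c'\<^sup>2 = 1"
    using k unfolding D8_mats_def by (elim insertE emptyE; simp)
  then show ?thesis using eq by (auto simp: power_mult_distrib)
qed

section \<open>Extra automorphisms over the fields with 3, 5, 7 and 13 elements\<close>

definition mod_scale :: "int \<Rightarrow> int \<Rightarrow> int \<times> int \<Rightarrow> int \<times> int"
  where "mod_scale p u s = ((u * fst s) mod p, (u * snd s) mod p)"

text \<open>
  A sufficient test for two directions over the field with \<open>p\<close> elements to be in one orbit
  of \<open>D8\<close>: up to a scalar \<open>u\<close>, they differ by one of four representatives of \<open>D8\<close> modulo its centre.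
\<close>

definition same_class :: "int \<Rightarrow> int \<times> int \<Rightarrow> int \<times> int \<Rightarrow> bool"
  where "same_class p s t \<longleftrightarrow> list_ex (\<lambda>u. mod_scale p 1 s \<in> set (map (mod_scale p u)
    [t, (fst t, - snd t), (snd t, fst t), (snd t, - fst t)])) [1..p - 1]"

fun int_vec_mat :: "int \<times> int \<Rightarrow> (int \<times> int) \<times> (int \<times> int) \<Rightarrow> int \<times> int"
  where "int_vec_mat (x, y) ((a, b), (c, d)) = (x * a + y * c, x * b + y * d)"

definition proj_points :: "int \<Rightarrow> (int \<times> int) list"
  where "proj_points p = (0, 1) # map (\<lambda>k. (1, k)) [0..p - 1]"

text \<open>
  Let \<open>reps\<close> represent the \<open>D8\<close>-orbits of directions. The matrix \<open>M\<close> maps each direction to one in the same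
  orbit or in an orbit linked to it by \<open>ls\<close>. Thus \<open>M\<close> preserves every union of orbits that does not
  separate linked orbits.
\<close>

definition links_respected :: "int \<Rightarrow> (int \<times> int) list \<Rightarrow> (int \<times> int) \<times> (int \<times> int) \<Rightarrow> (nat \<times> nat) list \<Rightarrow> bool"
  where "links_respected p reps M ls \<longleftrightarrow> list_all (\<lambda>P.
    list_ex (\<lambda>(i, j). same_class p P (reps ! i) \<and> same_class p (int_vec_mat P M) (reps ! j) \<or>
      same_class p P (reps ! j) \<and> same_class p (int_vec_mat P M) (reps ! i))
      (ls @ map (\<lambda>i. (i, i)) [0..<length reps])) (proj_points p)"

definition reps3 :: "(int \<times> int) list" where "reps3 = [(1, 0), (1, 1)]"
definition reps57 :: "(int \<times> int) list" where "reps57 = [(1, 0), (1, 1), (1, 2)]"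
definition reps13 :: "(int \<times> int) list" where "reps13 = [(1, 0), (1, 1), (1, 2), (1, 3), (1, 5)]"

text \<open>
  Each matrix in this and the next three lemmas lies outside \<open>D8\<close>, even up to scalars, but stabilises
  several unions of \<open>D8\<close>-orbits.
\<close>

lemma links3:
  "links_respected 3 reps3 ((1, 1), (1, -1)) [(0, 1)]"
  by code_simp

lemma links5:
  "links_respected 5 reps57 ((1, 0), (0, 2)) [(1, 2)]"
  "links_respected 5 reps57 ((1, 1), (1, -1)) [(0, 1)]"
  "links_respected 5 reps57 ((1, 2), (2, 1)) [(0, 2)]"
  by code_simp+

lemma links7:
  "links_respected 7 reps57 ((1, 0), (0, 2)) [(1, 2)]"
  "links_respected 7 reps57 ((1, 1), (1, -1)) [(0, 1)]"
  "links_respected 7 reps57 ((1, 2), (2, 1)) [(0, 2)]"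
  by code_simp+

text \<open>
  Whichever of the five orbits consist of directions of arcs, at least one of these seven matrices has all
  its linked pairs on the same side; see \<open>exists_automorphism_outside_13\<close>.
\<close>

lemma links13:
  "links_respected 13 reps13 ((1, 0), (0, 3)) [(1, 3), (2, 4)]"
  "links_respected 13 reps13 ((1, 0), (0, 5)) [(1, 4), (2, 3)]"
  "links_respected 13 reps13 ((1, 1), (1, -1)) [(0, 1), (2, 3)]"
  "links_respected 13 reps13 ((1, 1), (5, 8)) [(0, 1), (0, 4), (1, 4)]"
  "links_respected 13 reps13 ((1, 2), (2, 1)) [(0, 2), (3, 4)]"
  "links_respected 13 reps13 ((1, 3), (3, -1)) [(0, 3), (1, 2)]"
  "links_respected 13 reps13 ((1, 5), (5, 1)) [(0, 4), (2, 3)]"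
  by code_simp+

fun of_int_mat :: "(int \<times> int) \<times> (int \<times> int) \<Rightarrow> 'f::field mat2"
  where "of_int_mat (s, t) = (of_int_pair s, of_int_pair t)"

lemma vec_mat_of_int_pair: "vec_mat (of_int_pair s) (of_int_mat M) = of_int_pair (int_vec_mat s M)"
  by (cases s; cases M) (auto simp: vec_mat_def of_int_pair_def)

lemma direction_cases:
  fixes s :: "'f::{field,finite} \<times> 'f"
  assumes p: "prime CARD('f)" and s: "s \<noteq> 0"
  shows "\<exists>P\<in>set (proj_points (int CARD('f))). \<exists>c. c \<noteq> 0 \<and> s = (c * fst (of_int_pair P), c * snd (of_int_pair P))"
proof (cases "fst s = 0")
  case True
  then show ?thesis using s
    by (intro bexI[of _ "(0, 1)"] exI[of _ "snd s"]) (auto simp: prod_eq_iff of_int_pair_def proj_points_def)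
next
  case False
  obtain n where n: "n < CARD('f)" "snd s / fst s = of_nat n" using prime_field_of_nat[OF p] by blast
  then have "s = (fst s * fst (of_int_pair (1, int n)), fst s * snd (of_int_pair (1, int n)))"
    using False by (simp add: prod_eq_iff of_int_pair_def field_simps)
  moreover have "(1, int n) \<in> set (proj_points (int CARD('f)))"
    using n(1) by (auto simp: proj_points_def)
  ultimately show ?thesis using False by blast
qed

context invariant_digraph
begin

lemma arc_dir_same_class:
  assumes p: "prime CARD('f)" and sc: "same_class (int CARD('f)) s t" and t: "of_int_pair t \<noteq> (0 :: 'f \<times> 'f)"
  shows "arc_dir (of_int_pair s) = arc_dir (of_int_pair t)"
proof -
  let ?p = "int CARD('f)"
  have of_mod: "(of_int (k mod ?p) :: 'f) = of_int k" for k
    unfolding of_int_eq_iff_cong_CHAR CHAR_prime_field[OF p] by (simp add: cong_def)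
  have "\<exists>u\<in>set [1..?p - 1]. mod_scale ?p 1 s \<in> mod_scale ?p u ` set [t, (fst t, - snd t), (snd t, fst t), (snd t, - fst t)]"
    using sc by (simp only: same_class_def list_ex_iff set_map)
  then obtain u where u: "u \<in> set [1..?p - 1]"
    and im: "mod_scale ?p 1 s \<in> mod_scale ?p u ` set [t, (fst t, - snd t), (snd t, fst t), (snd t, - fst t)]"
    by blast
  obtain t' where t': "t' \<in> set [t, (fst t, - snd t), (snd t, fst t), (snd t, - fst t)]"
    and eq: "mod_scale ?p 1 s = mod_scale ?p u t'"
    using im by blast
  have "\<not> ?p dvd u" using u zdvd_not_zless by auto
  then have u0: "(of_int u :: 'f) \<noteq> 0" unfolding of_int_eq_0_prime_field[OF p] .
  have "of_int_pair (mod_scale ?p 1 s) = (of_int_pair s :: 'f \<times> 'f)"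
    by (simp add: of_int_pair_def mod_scale_def of_mod)
  moreover have "of_int_pair (mod_scale ?p u t') = (of_int u * fst (of_int_pair t'), of_int u * snd (of_int_pair t') :: 'f)"
    by (simp add: of_int_pair_def mod_scale_def of_mod)
  ultimately have s: "of_int_pair s = (of_int u * fst (of_int_pair t'), of_int u * snd (of_int_pair t') :: 'f)" using eq by simp
  obtain N where N: "N \<in> D8_mats" "of_int_pair t' = (vec_mat (of_int_pair t) N :: 'f \<times> 'f)"
  proof -
    have "vec_mat (of_int_pair t) ((1, 0), (0, 1)) = (of_int_pair t :: 'f \<times> 'f)"
      "vec_mat (of_int_pair t) ((1, 0), (0, -1)) = (of_int_pair (fst t, - snd t) :: 'f \<times> 'f)"
      "vec_mat (of_int_pair t) ((0, 1), (1, 0)) = (of_int_pair (snd t, fst t) :: 'f \<times> 'f)"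
      "vec_mat (of_int_pair t) ((0, -1), (1, 0)) = (of_int_pair (snd t, - fst t) :: 'f \<times> 'f)"
      by (simp_all add: vec_mat_def of_int_pair_def)
    moreover have "((1, 0), (0, 1)) \<in> (D8_mats :: 'f mat2 set)" "((1, 0), (0, -1)) \<in> (D8_mats :: 'f mat2 set)"
      "((0, 1), (1, 0)) \<in> (D8_mats :: 'f mat2 set)" "((0, -1), (1, 0)) \<in> (D8_mats :: 'f mat2 set)"
      by (simp_all add: D8_mats_def)
    moreover have "t' = t \<or> t' = (fst t, - snd t) \<or> t' = (snd t, fst t) \<or> t' = (snd t, - fst t)"
      using t' by simp
    ultimately show thesis using that by metis
  qed
  have "of_int_pair t' \<noteq> (0 :: 'f \<times> 'f)" unfolding N(2) by (rule vec_mat_neq_0[OF det_D8_mats[OF N(1)] t])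
  then show ?thesis unfolding s using arc_dir_scale[OF u0] arc_dir_D8[OF N(1) t] N(2) by simp
qed

lemma linked_automorphism:
  fixes M :: "(int \<times> int) \<times> (int \<times> int)"
  assumes p: "prime CARD('f)" and M: "det_mat (of_int_mat M :: 'f mat2) \<noteq> 0"
    and links: "links_respected (int CARD('f)) reps M ls"
    and reps: "\<forall>r\<in>set reps. of_int_pair r \<noteq> (0 :: 'f \<times> 'f)" and ls: "\<forall>(i, j)\<in>set ls. i < length reps \<and> j < length reps"
    and bits: "\<forall>(i, j)\<in>set ls. arc_dir (of_int_pair (reps ! i)) = arc_dir (of_int_pair (reps ! j))"
  shows "kron (of_int_mat M) id \<in> digraph_Aut E"
proof (rule linear_automorphism[OF M])
  fix s :: "'f \<times> 'f" assume "s \<noteq> 0"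
  then obtain P c where P: "P \<in> set (proj_points (int CARD('f)))" and c: "c \<noteq> 0"
    and s: "s = (c * fst (of_int_pair P), c * snd (of_int_pair P))" using direction_cases[OF p] by blast
  have P0: "of_int_pair P \<noteq> (0 :: 'f \<times> 'f)" using s \<open>s \<noteq> 0\<close> by (auto simp: prod_eq_iff)
  obtain i j where ij: "(i, j) \<in> set (ls @ map (\<lambda>i. (i, i)) [0..<length reps])"
    and "same_class (int CARD('f)) P (reps ! i) \<and> same_class (int CARD('f)) (int_vec_mat P M) (reps ! j) \<or>
      same_class (int CARD('f)) P (reps ! j) \<and> same_class (int CARD('f)) (int_vec_mat P M) (reps ! i)"
    using links P unfolding links_respected_def list_all_iff list_ex_iff by fast
  moreover have ij': "i < length reps \<and> j < length reps" "arc_dir (of_int_pair (reps ! i)) = arc_dir (of_int_pair (reps ! j))"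
    using ij ls bits by auto
  moreover have "of_int_pair (reps ! i) \<noteq> (0 :: 'f \<times> 'f)" "of_int_pair (reps ! j) \<noteq> (0 :: 'f \<times> 'f)"
    using reps ij'(1) by (metis nth_mem)+
  ultimately have "arc_dir (of_int_pair (int_vec_mat P M)) = arc_dir (of_int_pair P)"
    using arc_dir_same_class[OF p] by metis
  moreover have "vec_mat s (of_int_mat M) = (c * fst (of_int_pair (int_vec_mat P M)), c * snd (of_int_pair (int_vec_mat P M)))"
    unfolding vec_mat_of_int_pair[symmetric] s by (simp add: vec_mat_def algebra_simps)
  moreover have "of_int_pair (int_vec_mat P M) \<noteq> (0 :: 'f \<times> 'f)"
    unfolding vec_mat_of_int_pair[symmetric] by (rule vec_mat_neq_0[OF M P0])
  ultimately show "arc_dir (vec_mat s (of_int_mat M)) = arc_dir s"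
    using arc_dir_scale[OF c] P0 s by simp
qed

lemma exists_automorphism_outside:
  fixes M :: "(int \<times> int) \<times> (int \<times> int)"
  assumes "prime CARD('f)" and "det_mat (of_int_mat M :: 'f mat2) \<noteq> 0" and "\<not> scalar_D8 (of_int_mat M :: 'f mat2)"
    and "links_respected (int CARD('f)) reps M ls"
    and "\<forall>r\<in>set reps. of_int_pair r \<noteq> (0 :: 'f \<times> 'f)" and "\<forall>(i, j)\<in>set ls. i < length reps \<and> j < length reps"
    and "\<forall>(i, j)\<in>set ls. arc_dir (of_int_pair (reps ! i)) = arc_dir (of_int_pair (reps ! j))"
  shows "\<exists>g\<in>digraph_Aut E. g \<notin> G_group"
  using linked_automorphism[OF assms(1,2,4-7)] kron_in_G_group_imp_scalar_D8[OF assms(2)] assms(3) by blast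

lemma exists_automorphism_outside_5_7:
  assumes p: "CARD('f) = 5 \<or> CARD('f) = 7"
  shows "\<exists>g\<in>digraph_Aut E. g \<notin> G_group"
proof -
  have prime: "prime CARD('f)" using p by auto
  have zero: "(of_int k :: 'f) = 0 \<longleftrightarrow> int CARD('f) dvd k" for k by (rule of_int_eq_0_prime_field[OF prime])
  have nz: "(2 :: 'f) \<noteq> 0" "(3 :: 'f) \<noteq> 0"
    using zero[of 2] zero[of 3] p by auto
  then have ne: "(4 :: 'f) \<noteq> 1" using eq_iff_diff_eq_0[of "4 :: 'f" 1] by simp
  have det: "det_mat (of_int_mat ((1, 0), (0, 2)) :: 'f mat2) \<noteq> 0"
    "det_mat (of_int_mat ((1, 1), (1, -1)) :: 'f mat2) \<noteq> 0"
    "det_mat (of_int_mat ((1, 2), (2, 1)) :: 'f mat2) \<noteq> 0"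
    using nz by (simp_all add: det_mat_def det2_def of_int_pair_def)
  have sim: "\<not> scalar_D8 (of_int_mat ((1, 0), (0, 2)) :: 'f mat2)"
    "\<not> scalar_D8 (of_int_mat ((1, 1), (1, -1)) :: 'f mat2)"
    "\<not> scalar_D8 (of_int_mat ((1, 2), (2, 1)) :: 'f mat2)"
    using nz ne by (auto dest!: scalar_D8_D simp: of_int_pair_def)
  have links: "links_respected (int CARD('f)) reps57 ((1, 0), (0, 2)) [(1, 2)]"
    "links_respected (int CARD('f)) reps57 ((1, 1), (1, -1)) [(0, 1)]"
    "links_respected (int CARD('f)) reps57 ((1, 2), (2, 1)) [(0, 2)]"
    using p links5 links7 by auto
  have reps: "\<forall>r\<in>set reps57. of_int_pair r \<noteq> (0 :: 'f \<times> 'f)" by (simp add: reps57_def of_int_pair_def zero_prod_def)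
  note outside = exists_automorphism_outside[OF prime det(1) sim(1) links(1) reps]
    exists_automorphism_outside[OF prime det(2) sim(2) links(2) reps]
    exists_automorphism_outside[OF prime det(3) sim(3) links(3) reps]
  let ?b = "\<lambda>i. arc_dir (of_int_pair (reps57 ! i))"
  consider "?b 1 = ?b 2" | "?b 0 = ?b 1" | "?b 0 = ?b 2" by blast
  then show ?thesis
  proof cases
    case 1
    then show ?thesis by (intro outside(1)) (simp_all add: reps57_def)
  next
    case 2
    then show ?thesis by (intro outside(2)) (simp_all add: reps57_def)
  next
    case 3
    then show ?thesis by (intro outside(3)) (simp_all add: reps57_def)
  qed
qed

lemma exists_automorphism_outside_13:
  assumes p: "CARD('f) = 13"
  shows "\<exists>g\<in>digraph_Aut E. g \<notin> G_group"
proof -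
  have prime: "prime CARD('f)" using p by simp
  have zero: "(of_int k :: 'f) = 0 \<longleftrightarrow> 13 dvd k" for k
    using of_int_eq_0_prime_field[OF prime, of k] p by simp
  have nz: "(2 :: 'f) \<noteq> 0" "(3 :: 'f) \<noteq> 0" "(5 :: 'f) \<noteq> 0" "(8 :: 'f) \<noteq> 0" "(10 :: 'f) \<noteq> 0" "(24 :: 'f) \<noteq> 0"
    using zero[of 2] zero[of 3] zero[of 5] zero[of 8] zero[of 10] zero[of 24] by simp_all
  have ne: "(9 :: 'f) \<noteq> 1" "(25 :: 'f) \<noteq> 1"
    using zero[of 8] zero[of 24] eq_iff_diff_eq_0[of "9 :: 'f" 1] eq_iff_diff_eq_0[of "25 :: 'f" 1] by simp_all
  have det: "det_mat (of_int_mat ((1, 0), (0, 3)) :: 'f mat2) \<noteq> 0"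
    "det_mat (of_int_mat ((1, 0), (0, 5)) :: 'f mat2) \<noteq> 0"
    "det_mat (of_int_mat ((1, 1), (1, -1)) :: 'f mat2) \<noteq> 0"
    "det_mat (of_int_mat ((1, 1), (5, 8)) :: 'f mat2) \<noteq> 0"
    "det_mat (of_int_mat ((1, 2), (2, 1)) :: 'f mat2) \<noteq> 0"
    "det_mat (of_int_mat ((1, 3), (3, -1)) :: 'f mat2) \<noteq> 0"
    "det_mat (of_int_mat ((1, 5), (5, 1)) :: 'f mat2) \<noteq> 0"
    using nz by (simp_all add: det_mat_def det2_def of_int_pair_def)
  have sim: "\<not> scalar_D8 (of_int_mat ((1, 0), (0, 3)) :: 'f mat2)"
    "\<not> scalar_D8 (of_int_mat ((1, 0), (0, 5)) :: 'f mat2)"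
    "\<not> scalar_D8 (of_int_mat ((1, 1), (1, -1)) :: 'f mat2)"
    "\<not> scalar_D8 (of_int_mat ((1, 1), (5, 8)) :: 'f mat2)"
    "\<not> scalar_D8 (of_int_mat ((1, 2), (2, 1)) :: 'f mat2)"
    "\<not> scalar_D8 (of_int_mat ((1, 3), (3, -1)) :: 'f mat2)"
    "\<not> scalar_D8 (of_int_mat ((1, 5), (5, 1)) :: 'f mat2)"
    using nz ne by (auto dest!: scalar_D8_D simp: of_int_pair_def)
  have reps: "\<forall>r\<in>set reps13. of_int_pair r \<noteq> (0 :: 'f \<times> 'f)" by (simp add: reps13_def of_int_pair_def zero_prod_def)
  have links: "links_respected (int CARD('f)) reps13 ((1, 0), (0, 3)) [(1, 3), (2, 4)]"
    "links_respected (int CARD('f)) reps13 ((1, 0), (0, 5)) [(1, 4), (2, 3)]"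
    "links_respected (int CARD('f)) reps13 ((1, 1), (1, -1)) [(0, 1), (2, 3)]"
    "links_respected (int CARD('f)) reps13 ((1, 1), (5, 8)) [(0, 1), (0, 4), (1, 4)]"
    "links_respected (int CARD('f)) reps13 ((1, 2), (2, 1)) [(0, 2), (3, 4)]"
    "links_respected (int CARD('f)) reps13 ((1, 3), (3, -1)) [(0, 3), (1, 2)]"
    "links_respected (int CARD('f)) reps13 ((1, 5), (5, 1)) [(0, 4), (2, 3)]"
    unfolding p of_nat_numeral by (rule links13)+
  note outside = exists_automorphism_outside[OF prime det(1) sim(1) links(1) reps]
    exists_automorphism_outside[OF prime det(2) sim(2) links(2) reps]
    exists_automorphism_outside[OF prime det(3) sim(3) links(3) reps]
    exists_automorphism_outside[OF prime det(4) sim(4) links(4) reps]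
    exists_automorphism_outside[OF prime det(5) sim(5) links(5) reps]
    exists_automorphism_outside[OF prime det(6) sim(6) links(6) reps]
    exists_automorphism_outside[OF prime det(7) sim(7) links(7) reps]
  let ?b = "\<lambda>i. arc_dir (of_int_pair (reps13 ! i))"
  consider "?b 1 = ?b 3 \<and> ?b 2 = ?b 4" | "?b 1 = ?b 4 \<and> ?b 2 = ?b 3" | "?b 0 = ?b 1 \<and> ?b 2 = ?b 3"
    | "?b 0 = ?b 1 \<and> ?b 0 = ?b 4" | "?b 0 = ?b 2 \<and> ?b 3 = ?b 4" | "?b 0 = ?b 3 \<and> ?b 1 = ?b 2"
    | "?b 0 = ?b 4 \<and> ?b 2 = ?b 3"
    by argo
  then show ?thesis
  proof cases
    case 1
    then show ?thesis by (intro outside(1)) (simp_all add: reps13_def)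
  next
    case 2
    then show ?thesis by (intro outside(2)) (simp_all add: reps13_def)
  next
    case 3
    then show ?thesis by (intro outside(3)) (simp_all add: reps13_def)
  next
    case 4
    then show ?thesis by (intro outside(4)) (auto simp: reps13_def)
  next
    case 5
    then show ?thesis by (intro outside(5)) (simp_all add: reps13_def)
  next
    case 6
    then show ?thesis by (intro outside(6)) (simp_all add: reps13_def)
  next
    case 7
    then show ?thesis by (intro outside(7)) (simp_all add: reps13_def)
  qed
qed

text \<open>
  If the graph only distinguishes the two directions \<open>s\<close>, \<open>t\<close> from everything else, it is determined by the
  square grid with coordinates \<open>form s\<close>, \<open>form t\<close>. Then any permutation \<open>\<pi>\<close> of the first
  coordinate gives an automorphism, and for a transposition it is not affine.
\<close>

lemma two_directions_imp_automorphism_outside: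
  fixes s t :: "'f \<times> 'f"
  assumes st: "det2 s t \<noteq> 0" and card: "4 < CARD('f ^ 'm)"
    and bits: "\<And>r. r \<noteq> 0 \<Longrightarrow> arc_dir r = (if det2 r s = 0 \<or> det2 r t = 0 then bS else bO)"
    and gen: "\<And>d. generic d \<Longrightarrow> d \<in> diffs \<longleftrightarrow> bO"
  shows "\<exists>g\<in>digraph_Aut E. g \<notin> G_group"
proof -
  have s0: "s \<noteq> 0" and t0: "t \<noteq> 0" using det2_neq_0D[OF st] by simp_all
  have diffs_iff: "d \<in> diffs \<longleftrightarrow> (if form s d = 0 \<or> form t d = 0 then bS else bO)" if d: "d \<noteq> 0" for d
  proof -
    have on: "d \<in> diffs \<longleftrightarrow> bS" if "r = s \<or> r = t" "form r d = 0" for r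
      using diffs_rank_one[of r d] bits[of r] that d s0 t0 by auto
    have off: "d \<in> diffs \<longleftrightarrow> bO" if nst: "form s d \<noteq> 0" "form t d \<noteq> 0"
    proof (cases "generic d")
      case False
      then obtain r where r: "r \<noteq> 0" "form r d = 0" by (auto simp: generic_def)
      have "det2 r q \<noteq> 0" if "q = s \<or> q = t" for q
      proof
        assume "det2 r q = 0"
        then have "det2 q r = 0" using det2_swap by blast
        then obtain c where "q = (c * fst r, c * snd r)" using det2_eq_0_imp_multiple r(1) by blast
        then have "form q d = c *s form r d" by (simp add: form_def vec_eq_iff algebra_simps)
        then show False using r(2) nst that by auto
      qed
      then show ?thesis using diffs_rank_one[OF r(1) d r(2)] bits[OF r(1)] by auto
    qed (use gen in blast)
    show ?thesis using on[of s] on[of t] off by auto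
  qed
  have new: "\<exists>x. x \<notin> S" if "card S \<le> 4" for S :: "('f ^ 'm) set"
    using that card by (metis UNIV_eq_I not_less)
  obtain u :: "'f ^ 'm" where u: "u \<notin> {0}" using new[of "{0}"] by auto
  obtain v where v: "v \<notin> {0, u}" using new[of "{0, u}"] u by auto
  have "card {0, u, v, v - u} \<le> 4" by (simp add: card_insert_if)
  then obtain z where z: "z \<notin> {0, u, v, v - u}" using new by blast
  \<comment> \<open>The vector \<open>z\<close> is chosen so that \<open>\<pi>\<close> fixes \<open>z\<close> and \<open>u + z\<close>, which contradicts additivity as \<open>\<pi> u = v\<close>.\<close>
  define \<pi> where "\<pi> w = (if w = u then v else if w = v then u else w)" for w
  have \<pi>\<pi>: "\<pi> (\<pi> w) = w" for w by (simp add: \<pi>_def)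
  define F where "F x = (form s x, form t x)" for x :: "'f ^ (2 \<times> 'm)"
  have F: "bij F" unfolding F_def by (rule bij_forms[OF st])
  define g where "g x = inv_into UNIV F (\<pi> (form s x), form t x)" for x
  have Fg: "F (g x) = (\<pi> (form s x), form t x)" for x
    unfolding g_def by (rule surj_f_inv_f[OF bij_is_surj[OF F]])
  then have g: "form s (g x) = \<pi> (form s x)" "form t (g x) = form t x" for x
    by (simp_all add: F_def)
  have gg: "g (g x) = x" for x
    using form_eq_iff[OF st, of "g (g x)" x] by (simp add: g \<pi>\<pi>)
  then have bij: "bij g" by (intro o_bij[of g]) auto
  have \<pi>_eq: "\<pi> a = \<pi> b \<longleftrightarrow> a = b" for a b using \<pi>\<pi> by metis
  have "(x, y) \<in> E \<longleftrightarrow> (g x, g y) \<in> E" for x y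
  proof (cases "x = y")
    case True
    then show ?thesis by (simp add: arc_iff)
  next
    case False
    then have "g x \<noteq> g y" using gg by metis
    then have "x - y \<noteq> 0" "g x - g y \<noteq> 0" using False by auto
    then show ?thesis
      unfolding arc_iff by (simp add: diffs_iff form_diff g \<pi>_eq)
  qed
  then have "g \<in> digraph_Aut E" using bij by (simp add: digraph_Aut_def)
  moreover have "g \<notin> G_group"
  proof
    assume "g \<in> G_group"
    then obtain M B b where B: "B \<in> GL" and eq: "g = (\<lambda>x. kron M B x + b)" unfolding G_group_eq by blast
    have "\<pi> 0 = 0" using u v by (auto simp: \<pi>_def)
    then have "g 0 = 0" using form_eq_iff[OF st, of "g 0" 0] by (simp add: g)
    moreover have "kron M B 0 = 0" by (simp add: kron_def GL_linear[OF B])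
    ultimately have "b = 0" by (simp add: eq)
    then have "g (x + y) = g x + g y" for x y
      by (simp add: eq kron_def form_add GL_linear[OF B] stack_add)
    then have add: "\<pi> (form s x + form s y) = \<pi> (form s x) + \<pi> (form s y)" for x y
      by (metis form_add g(1))
    obtain x y where xy: "form s x = u" "form s y = z"
      using surjD[OF bij_is_surj[OF F], of "(u, 0)"] surjD[OF bij_is_surj[OF F], of "(z, 0)"]
      by (auto simp: F_def)
    have uz: "u + z \<noteq> u" "u + z \<noteq> v" using z by (auto simp: algebra_simps)
    have "u + z = v + z" using add[of x y] z uz unfolding xy \<pi>_def by simp
    then show False using v by simp
  qed
  ultimately show ?thesis by blast
qed

text \<open>
  There are two orbits of directions, \<open>{(1, 0), (0, 1)}\<close> and \<open>{(1, 1), (1, 2)}\<close>. If both or none consist of directions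
  of arcs, a linear map that swaps them works. Otherwise one of them behaves like
  the generic differences, and only the two directions of the other one are distinguished. In that
  case the linear automorphisms coming from \<open>GL(V)\<close> do not suffice.
\<close>

lemma exists_automorphism_outside_3:
  assumes p: "CARD('f) = 3" and m: "2 \<le> CARD('m)"
  shows "\<exists>g\<in>digraph_Aut E. g \<notin> G_group"
proof -
  have prime: "prime CARD('f)" using p by simp
  have zero: "(of_int k :: 'f) = 0 \<longleftrightarrow> 3 dvd k" for k
    using of_int_eq_0_prime_field[OF prime, of k] p by simp
  have two: "(2 :: 'f) \<noteq> 0" using zero[of 2] by simp
  have nz: "of_int_pair (1, k) \<noteq> (0 :: 'f \<times> 'f)" "of_int_pair (k, 1) \<noteq> (0 :: 'f \<times> 'f)" for k
    by (simp_all add: of_int_pair_def zero_prod_def)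
  let ?b0 = "arc_dir (of_int_pair (1, 0))" and ?b1 = "arc_dir (of_int_pair (1, 1))"
  have "(3 :: nat) ^ 2 \<le> 3 ^ CARD('m)" using m by (intro power_increasing) auto
  then have card: "4 < CARD('f ^ 'm)" by (simp add: p)
  have "same_class 3 (0, 1) (1, 0)" "same_class 3 (1, 2) (1, 1)" by code_simp+
  then have b: "arc_dir (of_int_pair (0, 1)) = ?b0" "arc_dir (of_int_pair (1, 2)) = ?b1"
    using arc_dir_same_class[OF prime, of "(0, 1)" "(1, 0)"] arc_dir_same_class[OF prime, of "(1, 2)" "(1, 1)"] nz
    by (simp_all add: p)
  have points: "proj_points 3 = [(0, 1), (1, 0), (1, 1), (1, 2)]" by code_simp
  have cases: "\<exists>P\<in>{(0, 1), (1, 0), (1, 1), (1, 2)}. arc_dir r = arc_dir (of_int_pair P) \<and> (\<forall>q. det2 r (of_int_pair q) = 0 \<longleftrightarrow> 3 dvd int_det2 P q)"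
    if "r \<noteq> 0" for r :: "'f \<times> 'f"
  proof -
    have "\<exists>P\<in>set (proj_points 3). \<exists>c. c \<noteq> 0 \<and> r = (c * fst (of_int_pair P), c * snd (of_int_pair P))"
      using direction_cases[OF prime that] by (simp only: p of_nat_numeral)
    then obtain P c where P: "P \<in> set (proj_points 3)" and c: "c \<noteq> 0" "r = (c * fst (of_int_pair P), c * snd (of_int_pair P))"
      by blast
    have "of_int_pair P \<noteq> (0 :: 'f \<times> 'f)" using c(2) that by (auto simp: prod_eq_iff)
    then have "arc_dir r = arc_dir (of_int_pair P)" unfolding c(2) by (rule arc_dir_scale[OF c(1)])
    moreover have "det2 r (of_int_pair q) = c * det2 (of_int_pair P) (of_int_pair q)" for q by (simp add: c(2) det2_def algebra_simps)
    ultimately show ?thesis using P c(1) unfolding points by (auto simp: det2_of_int_pair zero)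
  qed
  define \<rho> where "\<rho> \<longleftrightarrow> (\<exists>d. generic d \<and> d \<in> diffs)"
  have \<rho>: "d \<in> diffs \<longleftrightarrow> \<rho>" if "generic d" for d
    using diffs_generic that unfolding \<rho>_def by blast
  consider "?b0 = ?b1" | "\<rho> = ?b1" | "\<rho> = ?b0" by blast
  then show ?thesis
  proof cases
    case 1
    show ?thesis
    proof (rule exists_automorphism_outside[OF prime, where M = "((1, 1), (1, -1))" and ls = "[(0, 1)]" and reps = reps3])
      show "links_respected (int CARD('f)) reps3 ((1, 1), (1, -1)) [(0, 1)]" using links3 by (simp add: p)
      show "det_mat (of_int_mat ((1, 1), (1, -1)) :: 'f mat2) \<noteq> 0"
        using two by (simp add: det_mat_def det2_def of_int_pair_def)
      show "\<not> scalar_D8 (of_int_mat ((1, 1), (1, -1)) :: 'f mat2)"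
        by (auto dest!: scalar_D8_D simp: of_int_pair_def)
    qed (use 1 nz in \<open>auto simp: reps3_def\<close>)
  next
    case 2
    show ?thesis
    proof (rule two_directions_imp_automorphism_outside[OF _ card, where s = "of_int_pair (1, 0)" and t = "of_int_pair (0, 1)" and bS = ?b0 and bO = ?b1])
      fix r :: "'f \<times> 'f" assume "r \<noteq> 0"
      from cases[OF this] show "arc_dir r = (if det2 r (of_int_pair (1, 0)) = 0 \<or> det2 r (of_int_pair (0, 1)) = 0 then ?b0 else ?b1)"
        by (auto simp: b int_det2_def)
    qed (use \<rho> 2 in \<open>auto simp: det2_of_int_pair int_det2_def\<close>)
  next
    case 3
    show ?thesis
    proof (rule two_directions_imp_automorphism_outside[OF _ card, where s = "of_int_pair (1, 1)" and t = "of_int_pair (1, 2)" and bS = ?b1 and bO = ?b0])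
      fix r :: "'f \<times> 'f" assume "r \<noteq> 0"
      from cases[OF this] show "arc_dir r = (if det2 r (of_int_pair (1, 1)) = 0 \<or> det2 r (of_int_pair (1, 2)) = 0 then ?b1 else ?b0)"
        by (auto simp: b int_det2_def)
    qed (use \<rho> 3 in \<open>auto simp: det2_of_int_pair int_det2_def\<close>)
  qed
qed

end

section \<open>The classification\<close>

theorem theorem1p1:
  fixes m p :: nat
    and G :: "('f::{field,finite} ^ (2 \<times> 'm::finite) \<Rightarrow> 'f ^ (2 \<times> 'm)) set"
  assumes "m \<ge> 2" and "CARD('m) = m"
    and "prime p" and "odd p" and "CARD('f) = p"
    and "G = G_group"
  shows "(permutation_group G \<and> two_closed G \<and> \<not> regular_group G \<and>
           \<not> (\<exists>E. digraph E \<and> digraph_Aut E = G))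
         \<longleftrightarrow> p \<in> {3, 5, 7, 13}"
proof -
  have prime: "prime CARD('f)" and odd: "odd CARD('f)" and m: "CARD('m) \<ge> 2" using assms by simp_all
  have closed: "two_closed G"
    unfolding \<open>G = G_group\<close> G_group_eq_Int_Aut[OF prime odd m] by (rule two_closed_Int_digraph_Aut)
  then have perm: "permutation_group G" by (simp add: two_closed_def)
  have nonregular: "\<not> regular_group G"
    unfolding \<open>G = G_group\<close> by (rule not_regular_G_group[OF prime odd])
  have "\<not> (\<exists>E. digraph E \<and> digraph_Aut E = G)" if small: "p \<in> {3, 5, 7, 13}"
  proof
    assume "\<exists>E. digraph E \<and> digraph_Aut E = G"
    then obtain E where E: "digraph_Aut E = G" by blast
    then interpret invariant_digraph E by unfold_locales (simp add: assms)
    have "\<exists>g\<in>digraph_Aut E. g \<notin> G_group"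
      using small assms(5) m exists_automorphism_outside_3 exists_automorphism_outside_5_7 exists_automorphism_outside_13 by auto
    then show False using E assms(6) by blast
  qed
  moreover have "\<exists>E. digraph E \<and> digraph_Aut E = G" if "p \<notin> {3, 5, 7, 13}"
    using exists_digraph[where ?'f = 'f and ?'m = 'm] prime odd m that assms(5,6) by blast
  ultimately show ?thesis using closed perm nonregular by blast
qed

end
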